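(* Let $D$ be a division ring with center $F = Z(D)$, and let $N$ be a normal subgroup of the multiplicative group $D^*$. Suppose there exists a positive integer $d$ such that every element $x\in N$ is $n_x$-central for some positive integer $n_x\le d$. Then $N$ is central, i.e. $N\subseteq F$.
   Context: $D^* = D\setminus\{0\}$ denotes the group of units of $D$. For a positive integer $n$, an element $x\in D$ is called $n$-central if $x^{n}\in F$ and $x^m\notin F$ for every positive integer $m<n$. A subgroup $N$ of $D^*$ is called central if every element of $N$ is $1$-central, equivalently if $N\subseteq F$. *)

theory Defs
  imports "HOL-Algebra.Coset"
begin

definition center :: "'a::division_ring set"
  where "center = {z. \<forall>x. z * x = x * z}"

definition unit_group :: "'a::division_ring monoid"
  where "unit_group = \<lparr>carrier = UNIV - {0}, monoid.mult = (*), one = 1\<rparr>"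

definition n_central :: "nat \<Rightarrow> 'a::division_ring \<Rightarrow> bool"
  where "n_central n x \<longleftrightarrow>
    0 < n \<and> x ^ n \<in> center \<and> (\<forall>m. 0 < m \<and> m < n \<longrightarrow> x ^ m \<notin> center)"

lemma group_unit_group: "group (unit_group :: 'a::division_ring monoid)"
proof (rule groupI)
  fix x :: 'a
  assume "x \<in> carrier unit_group"
  then show "\<exists>y\<in>carrier unit_group. y \<otimes>\<^bsub>unit_group\<^esub> x = \<one>\<^bsub>unit_group\<^esub>"
    by (intro bexI[of _ "inverse x"]) (auto simp: unit_group_def)
qed (auto simp: unit_group_def mult.assoc)

end

theory Submission
  imports Defs "HOL-Computational_Algebra.Primes"
begin

text \<open>
  The order \<open>M = d!\<close> kills \<open>N\<close> modulo the center. If the center is infinite, an identity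
  \<open>w(l)\<^sup>M \<in> F\<close> that is polynomial in a central parameter \<open>l\<close> has central coefficients, so one may
  substitute for \<open>l\<close> the right multiplication by an element \<open>x \<in> N\<close> with \<open>x ^ r\<close> central. This
  makes \<open>q(v) = x ^ (r - 1) v + x ^ (r - 2) v x + \<dots> + v x ^ (r - 1)\<close> vanish on \<open>N\<close> unless \<open>x\<close>
  commutes with \<open>N\<close>; since \<open>q(1) = r x ^ (r - 1)\<close>, only \<open>r = char D\<close> is left, where \<open>q\<close> is the
  \<open>(r - 1)\<close>-st power of the derivation \<open>v \<mapsto> x v - v x\<close> and Leibniz' rule applies. Hence \<open>x\<close>
  commutes with its conjugates and is central.

  If the center is finite, \<open>N\<close> is torsion, and a noncentral \<open>a \<in> N\<close> satisfies \<open>b a = a ^ j b \<noteq> a b\<close> for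
  some \<open>b\<close>. With \<open>b ^ m\<close> commuting with \<open>a\<close>, either the centralizer of \<open>b ^ m\<close> has infinite center and
  the first case applies to it, or \<open>a\<close> and \<open>b\<close> generate a finite cyclic algebra, which is split
  because norms of finite fields are surjective.
\<close>

section \<open>Powers and commutation\<close>

lemma power_commute_right:
  fixes x y :: "'a::monoid_mult"
  assumes "x * y = y * x"
  shows "x ^ n * y = y * x ^ n"
  using assms by (induction n) (simp_all, metis mult.assoc)

lemma commute_cancel_left:
  fixes a :: "'a::division_ring"
  assumes "a \<noteq> 0" "a * s = s * a" "(a * b) * s = s * (a * b)"
  shows "b * s = s * b"
proof -
  have "a * (b * s) = a * (s * b)" using assms(2,3) by (metis mult.assoc)
  then show ?thesis using assms(1) by simp
qed

lemma inverse_mult_cancel_left: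
  fixes a b :: "'a::division_ring"
  shows "a \<noteq> 0 \<Longrightarrow> inverse a * (a * b) = b"
  by (simp add: mult.assoc[symmetric])

lemma sum_power_mult_diff_one:
  fixes h :: "'a::ring_1"
  shows "(\<Sum>j<k. h ^ j) * (h - 1) = h ^ k - 1"
  by (induction k) (simp_all add: algebra_simps power_commutes)

text \<open>Summation by parts. If \<open>h ^ k = 1\<close> and \<open>h \<noteq> 1\<close>, the
  right side is \<open>k\<close>, so \<open>h - 1\<close> divides the integer
  \<open>k\<close>.\<close>

lemma sum_of_nat_power_mult_diff_one:
  fixes h :: "'a::ring_1"
  shows "(\<Sum>j<k. of_nat j * h ^ j) * (h - 1) = of_nat k * h ^ k - (\<Sum>j<k. h ^ j) * h"
  by (induction k) (simp_all add: algebra_simps power_commutes)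

lemma mult_power_twist:
  fixes a b :: "'a::monoid_mult"
  assumes "b * a = a ^ j * b"
  shows "b * a ^ i = a ^ (j * i) * b"
proof (induction i)
  case (Suc i)
  have "b * a ^ Suc i = b * a ^ i * a" by (simp add: power_commutes mult.assoc)
  also have "\<dots> = a ^ (j * i) * (b * a)" unfolding Suc by (simp add: mult.assoc)
  also have "\<dots> = a ^ (j * Suc i) * b"
    unfolding assms by (simp add: mult.assoc[symmetric] power_add[symmetric] add.commute)
  finally show ?case .
qed simp

lemma power_eq_power_mod:
  fixes a :: "'a::monoid_mult"
  assumes "a ^ n = 1"
  shows "a ^ i = a ^ (i mod n)"
proof -
  have "a ^ i = (a ^ n) ^ (i div n) * a ^ (i mod n)"
    by (simp add: power_mult[symmetric] power_add[symmetric])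
  then show ?thesis using assms by simp
qed

section \<open>Polynomials acting by right multiplication\<close>

text \<open>
  \<open>horner [c\<^sub>0, c\<^sub>1, \<dots>] x v = c\<^sub>0 v + c\<^sub>1 v x + c\<^sub>2 v x\<^sup>2 + \<dots>\<close>: the indeterminate acts as a right
  multiplication. Evaluation \<open>horner cs x 1\<close> is not multiplicative when \<open>x\<close> is not
  central, but products of polynomials always act as compositions.
\<close>

primrec horner :: "'a::ring_1 list \<Rightarrow> 'a \<Rightarrow> 'a \<Rightarrow> 'a" where
  "horner [] x v = 0"
| "horner (c # cs) x v = c * v + horner cs x v * x"

primrec list_add :: "'a::ring_1 list \<Rightarrow> 'a list \<Rightarrow> 'a list" where
  "list_add [] ds = ds"
| "list_add (c # cs) ds = (case ds of [] \<Rightarrow> c # cs | d # ds' \<Rightarrow> (c + d) # list_add cs ds')"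

primrec list_mult :: "'a::ring_1 list \<Rightarrow> 'a list \<Rightarrow> 'a list" where
  "list_mult [] ds = []"
| "list_mult (c # cs) ds = list_add (map ((*) c) ds) (0 # list_mult cs ds)"

lemma horner_add: "horner cs x (u + v) = horner cs x u + horner cs x v"
  by (induction cs) (simp_all add: algebra_simps)

lemma horner_zero [simp]: "horner cs x 0 = 0"
  by (induction cs) simp_all

lemma horner_minus: "horner cs x (- v) = - horner cs x v"
  by (induction cs) (simp_all add: algebra_simps)

lemma horner_diff: "horner cs x (u - v) = horner cs x u - horner cs x v"
  using horner_add[of cs x u "- v"] by (simp add: horner_minus)

lemma horner_sum: "horner cs x (\<Sum>i\<in>I. f i) = (\<Sum>i\<in>I. horner cs x (f i))"
  by (induction I rule: infinite_finite_induct) (simp_all add: horner_add)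

lemma horner_mult_right:
  assumes "c * x = x * c"
  shows "horner cs x (v * c) = horner cs x v * c"
  using assms by (induction cs) (simp_all add: distrib_right mult.assoc)

lemma horner_mult_left:
  assumes "\<And>c. c \<in> set cs \<Longrightarrow> c * z = z * c"
  shows "horner cs x (z * v) = z * horner cs x v"
  using assms
proof (induction cs)
  case (Cons c cs)
  have "c * (z * v) = z * (c * v)"
    using Cons.prems[of c] by (metis list.set_intros(1) mult.assoc)
  then show ?case using Cons by (simp add: distrib_left mult.assoc)
qed simp

lemma horner_list_add: "horner (list_add cs ds) x v = horner cs x v + horner ds x v"
  by (induction cs arbitrary: ds) (auto simp: algebra_simps split: list.split)

lemma horner_map_mult: "horner (map ((*) c) ds) x v = c * horner ds x v"
  by (induction ds) (simp_all add: algebra_simps)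

lemma horner_list_mult: "horner (list_mult cs ds) x v = horner cs x (horner ds x v)"
  by (induction cs) (simp_all add: horner_list_add horner_map_mult horner_mult_right)

lemma horner_list_mult_funpow:
  "horner ((list_mult cs ^^ n) [1]) x v = (horner cs x ^^ n) v"
  by (induction n) (simp_all add: horner_list_mult)

lemma set_list_add:
  assumes "\<And>c d. c \<in> S \<Longrightarrow> d \<in> S \<Longrightarrow> c + d \<in> S" "set cs \<subseteq> S" "set ds \<subseteq> S"
  shows "set (list_add cs ds) \<subseteq> S"
  using assms(2,3)
proof (induction cs arbitrary: ds)
  case (Cons c cs)
  then show ?case using Cons.IH[of "tl ds"] by (cases ds) (auto simp: assms(1))
qed simp

lemma set_list_mult:
  assumes "\<And>c d. c \<in> S \<Longrightarrow> d \<in> S \<Longrightarrow> c + d \<in> S" "\<And>c d. c \<in> S \<Longrightarrow> d \<in> S \<Longrightarrow> c * d \<in> S"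
    and "0 \<in> S" "set cs \<subseteq> S" "set ds \<subseteq> S"
  shows "set (list_mult cs ds) \<subseteq> S"
  using assms(4)
proof (induction cs)
  case (Cons c cs)
  then show ?case
    unfolding list_mult.simps using assms(1-3,5)
    by (intro set_list_add) (auto dest: subsetD)
qed simp

section \<open>Synthetic division and polynomials with infinitely many commuting roots\<close>

primrec synthetic :: "'a::ring_1 list \<Rightarrow> 'a \<Rightarrow> 'a list" where
  "synthetic [] m = []"
| "synthetic (c # cs) m = horner (c # cs) m 1 # synthetic cs m"

lemma length_synthetic [simp]: "length (synthetic cs m) = length cs"
  by (induction cs) simp_all

lemma set_synthetic_commute:
  fixes l :: "'a::ring_1"
  assumes "\<And>c. c \<in> set cs \<Longrightarrow> c * l = l * c" "m * l = l * m" "d \<in> set (synthetic cs m)"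
  shows "d * l = l * d"
proof -
  have *: "horner cs m 1 * l = l * horner cs m 1"
    if "\<And>c. c \<in> set cs \<Longrightarrow> c * l = l * c" for cs
    using horner_mult_right[of l m cs 1] horner_mult_left[of cs l m 1] that assms(2) by simp
  show ?thesis using assms(1,3)
  proof (induction cs)
    case (Cons c cs)
    show ?case
    proof (cases "d = horner (c # cs) m 1")
      case True
      then show ?thesis using *[of "c # cs"] Cons.prems(1) by metis
    next
      case False
      then show ?thesis using Cons by (simp del: horner.simps)
    qed
  qed simp
qed

text \<open>Horner's scheme: the tails of \<open>cs\<close>, evaluated at \<open>m\<close>, are the
  coefficients of the quotient by \<open>X - m\<close>. Evaluation at \<open>l\<close> respects the
  product since \<open>l\<close> commutes with \<open>m\<close>.\<close>

lemma horner_diff_synthetic: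
  fixes l :: "'a::ring_1"
  assumes "l * m = m * l" "\<And>c. c \<in> set cs \<Longrightarrow> c * l = l * c" "\<And>c. c \<in> set cs \<Longrightarrow> c * m = m * c"
  shows "horner (c # cs) l 1 - horner (c # cs) m 1 = horner (synthetic cs m) l 1 * (l - m)"
  using assms(2,3)
proof (induction cs arbitrary: c)
  case (Cons d ds)
  let ?h = "\<lambda>l. horner (d # ds) l 1" let ?s = "horner (synthetic ds m) l 1"
  have IH: "?h l - ?h m = ?s * (l - m)"
    by (rule Cons.IH) (metis Cons.prems list.set_intros(2))+
  have "horner (c # d # ds) l 1 - horner (c # d # ds) m 1 = ?h l * l - ?h m * m"
    by simp
  also have "\<dots> = (?h l - ?h m) * l + ?h m * (l - m)"
    by (simp add: algebra_simps)
  also have "\<dots> = ?s * ((l - m) * l) + ?h m * (l - m)"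
    unfolding IH by (simp add: mult.assoc)
  also have "(l - m) * l = l * (l - m)"
    using assms(1) by (simp add: algebra_simps)
  finally show ?case by (simp add: algebra_simps)
qed simp

text \<open>Induction on the length, used twice. Dividing \<open>c # ds\<close> by
  \<open>X - m\<close> leaves a shorter polynomial that vanishes on \<open>L - {m}\<close>, hence is
  zero; its first coefficient is the value of \<open>ds\<close> at \<open>m\<close>. So
  \<open>ds\<close> vanishes on \<open>L\<close> and is zero, and then so is
  \<open>c\<close>.\<close>

lemma horner_infinite_roots:
  fixes L :: "'a::division_ring set"
  assumes "infinite L" "\<And>l m. l \<in> L \<Longrightarrow> m \<in> L \<Longrightarrow> l * m = m * l"
    and "\<And>c l. c \<in> set cs \<Longrightarrow> l \<in> L \<Longrightarrow> c * l = l * c"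
    and "\<And>l. l \<in> L \<Longrightarrow> horner cs l 1 = 0"
  shows "set cs \<subseteq> {0}"
  using assms
proof (induction "length cs" arbitrary: cs L)
  case (Suc n)
  then obtain c ds where cs: "cs = c # ds" and n: "n = length ds"
    by (cases cs) auto
  have "horner ds m 1 = 0" if m: "m \<in> L" for m
  proof -
    have inf: "infinite (L - {m})" using Suc.prems(1) by simp
    have comm: "c * l = l * c" if "c \<in> set ds" "l \<in> L" for c l
      using Suc.prems(3) that cs by (meson list.set_intros(2))
    have z: "horner (synthetic ds m) l 1 = 0" if l: "l \<in> L - {m}" for l
    proof -
      have "horner (synthetic ds m) l 1 * (l - m) = horner (c # ds) l 1 - horner (c # ds) m 1"
        by (rule horner_diff_synthetic[symmetric, OF Suc.prems(2)]) (use comm m l in blast)+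
      also have "\<dots> = 0" using Suc.prems(4) m l by (simp add: cs del: horner.simps)
      finally show ?thesis using l by simp
    qed
    have "set (synthetic ds m) \<subseteq> {0}"
    proof (rule Suc.hyps(1)[OF _ inf])
      show "e * l = l * e" if "e \<in> set (synthetic ds m)" "l \<in> L - {m}" for e l
        by (rule set_synthetic_commute[OF comm Suc.prems(2) that(1)]) (use m that in blast)+
      show "l * m' = m' * l" if "l \<in> L - {m}" "m' \<in> L - {m}" for l m'
        using Suc.prems(2) that by blast
    qed (use z n in auto)
    then show ?thesis by (cases ds) auto
  qed
  then have "set ds \<subseteq> {0}"
    by (intro Suc.hyps(1)[OF n Suc.prems(1,2)]) (metis Suc.prems(3) cs list.set_intros(2))+
  moreover obtain l where "l \<in> L" using Suc.prems(1) by fastforce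
  ultimately show ?case
    using Suc.prems(4)[of l] \<open>\<And>m. m \<in> L \<Longrightarrow> horner ds m 1 = 0\<close> by (simp add: cs)
qed simp

section \<open>The quotient of \<open>x ^ n - X ^ n\<close> by \<open>x - X\<close>, and its form in
  characteristic \<open>p\<close>\<close>

primrec quotient_list :: "'a::ring_1 \<Rightarrow> nat \<Rightarrow> 'a list" where
  "quotient_list x 0 = []"
| "quotient_list x (Suc n) = x ^ n # quotient_list x n"

lemma diff_horner_quotient_list:
  "x * horner (quotient_list x n) l v - horner (quotient_list x n) l v * l = x ^ n * v - v * l ^ n"
proof (induction n)
  case (Suc n)
  let ?q = "horner (quotient_list x n) l v"
  have "x * horner (quotient_list x (Suc n)) l v - horner (quotient_list x (Suc n)) l v * l
      = x ^ Suc n * v - x ^ n * v * l + (x * ?q - ?q * l) * l"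
    by (simp add: algebra_simps)
  also have "\<dots> = x ^ Suc n * v - v * l ^ Suc n"
    unfolding Suc by (simp add: algebra_simps power_commutes)
  finally show ?case .
qed simp

text \<open>Left multiplication by \<open>x\<close> and right multiplication by \<open>l\<close>
  commute as operators, so the factorization of \<open>x ^ n - l ^ n\<close> holds in either order
  even if \<open>x\<close> and \<open>l\<close> do not commute.\<close>

lemma horner_quotient_list_diff:
  fixes x :: "'a::ring_1"
  shows "horner (quotient_list x n) l (x * v - v * l) = x ^ n * v - v * l ^ n"
proof -
  have "horner (quotient_list x n) l (x * v) = x * horner (quotient_list x n) l v"
    by (rule horner_mult_left) (induction n, auto simp: power_commutes)
  then show ?thesis
    by (simp add: horner_diff horner_mult_right diff_horner_quotient_list)
qed

lemma horner_quotient_list_one: "horner (quotient_list x n) x 1 = of_nat n * x ^ (n - 1)"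
proof (induction n)
  case (Suc n)
  then show ?case by (cases n) (simp_all add: algebra_simps power_commutes)
qed simp

lemma horner_quotient_list_sum:
  "horner (quotient_list x (Suc n)) y v = (\<Sum>j\<le>n. x ^ (n - j) * v * y ^ j)"
proof (induction n)
  case (Suc n)
  have "horner (quotient_list x (Suc (Suc n))) y v = x ^ Suc n * v + (\<Sum>j\<le>n. x ^ (n - j) * v * y ^ j) * y"
    unfolding quotient_list.simps(2)[of x "Suc n"] horner.simps(2)[of _ "quotient_list x (Suc n)"] Suc ..
  also have "\<dots> = x ^ Suc n * v + (\<Sum>j\<le>n. x ^ (Suc n - Suc j) * v * y ^ Suc j)"
    by (simp add: sum_distrib_right mult.assoc power_commutes)
  finally show ?case by (subst sum.atMost_Suc_shift) simp
qed simp

text \<open>The binomial theorem for two commuting operators, left multiplication by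
  \<open>x\<close> and right multiplication by \<open>y\<close>.\<close>

lemma funpow_diff_binomial:
  fixes x y v :: "'a::ring_1"
  shows "((\<lambda>v. x * v - v * y) ^^ n) v = (\<Sum>j\<le>n. of_int ((-1) ^ j * int (n choose j)) * (x ^ (n - j) * v * y ^ j))"
proof (induction n)
  case (Suc n)
  let ?D = "\<lambda>v. x * v - v * y"
  let ?c = "\<lambda>m j. of_int ((-1) ^ j * int (m choose j)) :: 'a"
  let ?t = "\<lambda>j. x ^ (Suc n - j) * v * y ^ j"
  have comm: "x * (?c n j * w) = ?c n j * (x * w)" for j w
    by (metis mult.assoc mult_of_int_commute)
  have pascal: "?c n (Suc j) - ?c n j = ?c (Suc n) (Suc j)" for j
    unfolding of_int_diff[symmetric] by (rule arg_cong[where f = of_int]) (simp add: algebra_simps)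
  have "(?D ^^ Suc n) v = ?D (\<Sum>j\<le>n. ?c n j * (x ^ (n - j) * v * y ^ j))"
    using Suc by simp
  also have "\<dots> = (\<Sum>j\<le>n. ?c n j * (x * (x ^ (n - j) * v * y ^ j)))
      - (\<Sum>j\<le>n. ?c n j * (x ^ (n - j) * v * y ^ j * y))"
    by (simp only: sum_distrib_left sum_distrib_right comm) (simp only: mult.assoc)
  also have "(\<Sum>j\<le>n. ?c n j * (x * (x ^ (n - j) * v * y ^ j))) = (\<Sum>j\<le>n. ?c n j * ?t j)"
    by (intro sum.cong refl) (simp add: Suc_diff_le mult.assoc)
  also have "\<dots> = (\<Sum>j\<le>Suc n. ?c n j * ?t j)"
    by (simp add: binomial_eq_0)
  also have "\<dots> = ?c n 0 * ?t 0 + (\<Sum>j\<le>n. ?c n (Suc j) * ?t (Suc j))"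
    by (rule sum.atMost_Suc_shift)
  also have "(\<Sum>j\<le>n. ?c n j * (x ^ (n - j) * v * y ^ j * y)) = (\<Sum>j\<le>n. ?c n j * ?t (Suc j))"
    by (intro sum.cong refl) (simp add: power_Suc2 mult.assoc del: power_Suc)
  also have "?c n 0 * ?t 0 + (\<Sum>j\<le>n. ?c n (Suc j) * ?t (Suc j)) - (\<Sum>j\<le>n. ?c n j * ?t (Suc j))
      = ?c n 0 * ?t 0 + (\<Sum>j\<le>n. (?c n (Suc j) - ?c n j) * ?t (Suc j))"
    by (simp only: sum_subtractf left_diff_distrib add_diff_eq)
  also have "\<dots> = ?c (Suc n) 0 * ?t 0 + (\<Sum>j\<le>n. ?c (Suc n) (Suc j) * ?t (Suc j))"
    by (simp only: pascal binomial_n_0)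
  also have "\<dots> = (\<Sum>j\<le>Suc n. ?c (Suc n) j * ?t j)"
    by (rule sum.atMost_Suc_shift[symmetric])
  finally show ?case .
qed simp

text \<open>By Pascal's rule, neighbouring entries of row \<open>p - 1\<close> add up to an inner
  entry of row \<open>p\<close>, a multiple of \<open>p\<close>. So modulo \<open>p\<close> the row
  alternates in sign, starting from 1.\<close>

lemma minus_one_power_times_choose_char:
  assumes "prime p" "of_nat p = (0 :: 'a::ring_1)" "j \<le> p - 1"
  shows "of_int ((-1) ^ j * int (p - 1 choose j)) = (1 :: 'a)"
  using assms(3)
proof (induction j)
  case (Suc j)
  have "p dvd (p choose Suc j)"
    using Suc.prems assms(1) by (intro dvd_choose_prime) auto
  then have "of_nat (p choose Suc j) = (0 :: 'a)"
    using assms(2) by (auto elim!: dvdE)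
  moreover have "p choose Suc j = (p - 1 choose j) + (p - 1 choose Suc j)"
    using prime_gt_0_nat[OF assms(1)] by (cases p) auto
  ultimately have "of_nat (p - 1 choose Suc j) = - (of_nat (p - 1 choose j) :: 'a)"
    by (simp add: add_eq_0_iff)
  then show ?case using Suc by simp
qed simp

text \<open>As operators, \<open>(X - Y) ^ (p - 1) = (X ^ p - Y ^ p) / (X - Y)\<close>; for
  \<open>y = x\<close> the left side is an iterated derivation.\<close>

lemma funpow_diff_char:
  fixes x y v :: "'a::ring_1"
  assumes "prime p" "of_nat p = (0 :: 'a)"
  shows "((\<lambda>v. x * v - v * y) ^^ (p - 1)) v = horner (quotient_list x p) y v"
proof -
  have "((\<lambda>v. x * v - v * y) ^^ (p - 1)) v = (\<Sum>j\<le>p - 1. x ^ (p - 1 - j) * v * y ^ j)"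
    unfolding funpow_diff_binomial
    by (intro sum.cong refl) (simp only: minus_one_power_times_choose_char[OF assms] atMost_iff mult_1_left)
  also have "\<dots> = horner (quotient_list x (Suc (p - 1))) y v"
    by (rule horner_quotient_list_sum[symmetric])
  finally show ?thesis using prime_gt_0_nat[OF assms(1)] by simp
qed

lemma prime_power_eq_one_char:
  fixes h :: "'a::division_ring"
  assumes "prime p" "of_nat p = (0 :: 'a)" "h ^ p = 1"
  shows "h = 1"
proof -
  \<comment> \<open>With \<open>y = 1\<close> the operator is left multiplication by
    \<open>h - 1\<close>, so the identity becomes \<open>(h - 1) ^ p = h ^ p - 1\<close>.\<close>
  let ?D = "\<lambda>v. h * v - v * 1"
  have "(?D ^^ n) 1 = (h - 1) ^ n" for n
    by (induction n) (simp_all add: algebra_simps)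
  moreover have "?D ((?D ^^ (p - 1)) 1) = h ^ p * 1 - 1 * 1 ^ p"
    unfolding funpow_diff_char[OF assms(1,2)] by (rule diff_horner_quotient_list)
  ultimately have "(h - 1) * (h - 1) ^ (p - 1) = 0"
    using assms(3) by (simp add: algebra_simps)
  then show ?thesis by auto
qed

lemma of_nat_eq_0_prime_dvd:
  assumes "of_nat k = (0 :: 'a::division_ring)" "0 < k"
  shows "\<exists>p. prime p \<and> p dvd k \<and> of_nat p = (0 :: 'a)"
  using assms
proof (induction k rule: less_induct)
  case (less k)
  then have "k \<noteq> 1" by auto
  then obtain p where p: "prime p" "p dvd k" using prime_factor_nat by blast
  then obtain j where j: "k = p * j" by blast
  then have "of_nat p = (0 :: 'a) \<or> of_nat j = (0 :: 'a)" using less.prems by simp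
  moreover have "0 < j" "j < k" using j less.prems(2) prime_gt_1_nat[OF p(1)] by auto
  ultimately show ?case using less.IH[of j] p j by (metis dvd_mult)
qed

text \<open>If the characteristic \<open>p\<close> divided the order \<open>k = p * j\<close>, then
  \<open>h ^ j\<close> would be a \<open>p\<close>-th root of unity, hence 1, against the minimality
  of \<open>k\<close>.\<close>

lemma of_nat_order_nonzero:
  fixes h :: "'a::division_ring"
  assumes "0 < k" "h ^ k = 1" "\<And>j. 0 < j \<Longrightarrow> j < k \<Longrightarrow> h ^ j \<noteq> 1"
  shows "of_nat k \<noteq> (0 :: 'a)"
proof
  assume "of_nat k = (0 :: 'a)"
  then obtain p j where p: "prime p" "of_nat p = (0 :: 'a)" and j: "k = p * j"
    using of_nat_eq_0_prime_dvd assms(1) by blast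
  have "h ^ j = 1"
    by (rule prime_power_eq_one_char[OF p]) (use assms(2) j in \<open>simp add: power_mult[symmetric] mult.commute\<close>)
  moreover have "0 < j" "j < k" using j assms(1) prime_gt_1_nat[OF p(1)] by auto
  ultimately show False using assms(3) by blast
qed

section \<open>Infinite center\<close>

text \<open>A subset instead of the whole type, because the infinite-center theorem is applied again
  to a centralizer.\<close>

locale division_subring =
  fixes S :: "'a::division_ring set"
  assumes one_mem [simp]: "1 \<in> S"
    and diff_mem [simp]: "a \<in> S \<Longrightarrow> b \<in> S \<Longrightarrow> a - b \<in> S"
    and mult_mem [simp]: "a \<in> S \<Longrightarrow> b \<in> S \<Longrightarrow> a * b \<in> S"
    and inverse_mem [simp]: "a \<in> S \<Longrightarrow> inverse a \<in> S"
begin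

lemma zero_mem [simp]: "0 \<in> S"
  using diff_mem[of 1 1] by simp

lemma minus_mem [simp]: "a \<in> S \<Longrightarrow> - a \<in> S"
  using diff_mem[of 0 a] by simp

lemma add_mem [simp]: "a \<in> S \<Longrightarrow> b \<in> S \<Longrightarrow> a + b \<in> S"
  using diff_mem[of a "- b"] by simp

lemma power_mem [simp]: "a \<in> S \<Longrightarrow> a ^ n \<in> S"
  by (induction n) simp_all

lemma horner_mem: "set cs \<subseteq> S \<Longrightarrow> x \<in> S \<Longrightarrow> v \<in> S \<Longrightarrow> horner cs x v \<in> S"
  by (induction cs) auto

lemma set_quotient_list: "x \<in> S \<Longrightarrow> set (quotient_list x n) \<subseteq> S"
  by (induction n) auto

definition Z :: "'a set" where "Z = {z \<in> S. \<forall>s\<in>S. z * s = s * z}"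

lemma Z_mem: "z \<in> Z \<Longrightarrow> z \<in> S"
  and Z_commute: "z \<in> Z \<Longrightarrow> s \<in> S \<Longrightarrow> z * s = s * z"
  by (auto simp: Z_def)

lemma Z_I: "z \<in> S \<Longrightarrow> (\<And>s. s \<in> S \<Longrightarrow> z * s = s * z) \<Longrightarrow> z \<in> Z"
  by (simp add: Z_def)

lemma division_subring_Z: "division_subring Z"
proof
  show "inverse a \<in> Z" if a: "a \<in> Z" for a
  proof (cases "a = 0")
    case False
    have "inverse a * s = s * inverse a" if "s \<in> S" for s
      by (rule commute_cancel_left[of a]) (simp_all add: False Z_commute[OF a that])
    then show ?thesis by (rule Z_I[OF inverse_mem[OF Z_mem[OF a]]])
  next
    case True
    then show ?thesis using a by (simp only: inverse_zero)
  qed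
  show "a * b \<in> Z" if ab: "a \<in> Z" "b \<in> Z" for a b
  proof (rule Z_I)
    fix s assume s: "s \<in> S"
    have "a * b * s = a * (s * b)" by (simp only: mult.assoc Z_commute[OF ab(2) s])
    also have "\<dots> = a * s * b" by (simp only: mult.assoc)
    also have "\<dots> = s * a * b" by (simp only: Z_commute[OF ab(1) s])
    finally show "a * b * s = s * (a * b)" by (simp only: mult.assoc)
  qed (simp add: ab Z_mem)
  show "a - b \<in> Z" if "a \<in> Z" "b \<in> Z" for a b
    by (rule Z_I) (simp_all add: that Z_mem left_diff_distrib right_diff_distrib Z_commute)
  show "1 \<in> Z"
    by (rule Z_I) simp_all
qed

text \<open>For \<open>s\<close> in \<open>S\<close> the polynomial with coefficients
  \<open>c * s - s * c\<close> vanishes at every element of the infinite center, so it is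
  zero.\<close>

lemma coeffs_in_Z:
  assumes "infinite Z" "set cs \<subseteq> S" "\<And>l. l \<in> Z \<Longrightarrow> horner cs l 1 \<in> Z"
  shows "set cs \<subseteq> Z"
proof
  fix c assume c: "c \<in> set cs"
  have "c * s = s * c" if s: "s \<in> S" for s
  proof -
    let ?ds = "map (\<lambda>c. c * s - s * c) cs"
    have eq: "horner ?ds l 1 = horner cs l 1 * s - s * horner cs l 1" if "l \<in> Z" for l
    proof -
      have "horner ?ds l 1 = horner cs l s - s * horner cs l 1"
      proof (induction cs)
        case (Cons c cs)
        then show ?case by (simp add: left_diff_distrib right_diff_distrib distrib_left mult.assoc)
      qed simp
      also have "horner cs l s = horner cs l 1 * s"
        using horner_mult_right[of s l cs 1] Z_commute[OF that s] by simp
      finally show ?thesis .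
    qed
    have "set ?ds \<subseteq> {0}"
    proof (rule horner_infinite_roots[OF assms(1)])
      show "horner ?ds l 1 = 0" if "l \<in> Z" for l
        using eq[OF that] Z_commute[OF assms(3)[OF that] s] by simp
      show "d * l = l * d" if "d \<in> set ?ds" "l \<in> Z" for d l
      proof -
        have "d \<in> S" using that(1) s assms(2) by auto
        then show ?thesis using Z_commute that(2) by metis
      qed
    qed (use Z_commute Z_mem in blast)
    then show ?thesis using c by auto
  qed
  then show "c \<in> Z" using c assms(2) by (auto simp: Z_def)
qed

lemma horner_Z_coeffs:
  assumes "set cs \<subseteq> Z" "v \<in> S"
  shows "horner cs x v = v * horner cs x 1"
  using horner_mult_left[of cs v x 1] assms Z_commute by auto

text \<open>Compare conjugation by \<open>y\<close> with conjugation by \<open>1 + y\<close>.\<close>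

lemma commutes_with_conjugates_imp_central:
  assumes "x \<in> S"
    and comm: "\<And>y. y \<in> S \<Longrightarrow> y \<noteq> 0 \<Longrightarrow> x * (y * x * inverse y) = (y * x * inverse y) * x"
  shows "x \<in> Z"
proof -
  have "x * y = y * x" if y: "y \<in> S" for y
  proof (cases "y = 0 \<or> y = -1")
    case False
    then have y0: "y \<noteq> 0" and y1: "1 + y \<noteq> 0"
      by (auto simp: add_eq_0_iff)
    define u where "u = y * x * inverse y"
    define z where "z = (1 + y) * x * inverse (1 + y)"
    have u: "u * y = y * x" "x * u = u * x"
      using y0 comm[OF y] by (simp_all add: u_def mult.assoc)
    have z: "z * (1 + y) = (1 + y) * x" "x * z = z * x"
      using y1 comm[of "1 + y"] y by (simp_all add: z_def mult.assoc)
    \<comment> \<open>Subtract \<open>u * y = y * x\<close> from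
      \<open>z * (1 + y) = (1 + y) * x\<close>. Both \<open>z - x\<close> and \<open>u - z\<close>
      commute with \<open>x\<close>, hence so does \<open>y\<close>, unless \<open>u = z\<close>;
      then both equal \<open>x\<close>.\<close>
    have eq: "z - x = (u - z) * y"
      using u(1) z(1) by (simp add: algebra_simps)
    show ?thesis
    proof (cases "u = z")
      case True
      then show ?thesis using eq u(1) by simp
    next
      case False
      have "y * x = x * y"
      proof (rule commute_cancel_left[of "u - z"])
        show "(u - z) * y * x = x * ((u - z) * y)"
          unfolding eq[symmetric] using z(2) by (simp add: algebra_simps)
      qed (use False u(2) z(2) in \<open>auto simp: algebra_simps\<close>)
      then show ?thesis by simp
    qed
  qed auto
  then show ?thesis using assms(1) by (simp add: Z_def)
qed

end

section \<open>Normal subgroups whose \<open>M\<close>-th powers are central\<close>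

locale power_central_normal = division_subring +
  fixes N :: "'a set" and M :: nat
  assumes N_subset: "N \<subseteq> S - {0}"
    and N_one [simp]: "1 \<in> N"
    and N_mult [simp]: "a \<in> N \<Longrightarrow> b \<in> N \<Longrightarrow> a * b \<in> N"
    and N_inverse [simp]: "a \<in> N \<Longrightarrow> inverse a \<in> N"
    and N_conj: "a \<in> N \<Longrightarrow> y \<in> S \<Longrightarrow> y \<noteq> 0 \<Longrightarrow> y * a * inverse y \<in> N"
    and M_pos: "0 < M"
    and N_power: "a \<in> N \<Longrightarrow> a ^ M \<in> Z"
begin

interpretation center: division_subring Z
  by (rule division_subring_Z)

lemma N_mem [simp]: "a \<in> N \<Longrightarrow> a \<in> S"
  and N_nonzero: "a \<in> N \<Longrightarrow> a \<noteq> 0"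
  using N_subset by auto

lemma N_pow [simp]: "a \<in> N \<Longrightarrow> a ^ n \<in> N"
  by (induction n) simp_all

text \<open>
  For \<open>l\<close> in the center, put \<open>q\<^sub>l = (x ^ r - l ^ r) / (x - l)\<close>. Then \<open>(x - l) a q\<^sub>l g\<close> is a
  central multiple of an element of \<open>N\<close>, so its \<open>M\<close>-th power, a polynomial in \<open>l\<close>, has central
  values and hence central coefficients. Substituting for \<open>l\<close> the right multiplication by \<open>x\<close>
  turns this power into an operator \<open>T ^ M\<close> that is the right multiplication by some \<open>\<rho>\<close>; since
  \<open>q\<close> becomes an operator annihilating commutators with \<open>x\<close>, \<open>T\<close> has a kernel and \<open>\<rho> = 0\<close>.
\<close>

lemma quotient_annihilates_commutators:
  assumes inf: "infinite Z" and x: "x \<in> N" "x ^ r \<in> Z" and a: "a \<in> N" and g: "g \<in> N"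
  shows "horner (quotient_list x r) x (g * (x * a - a * x)) = 0"
proof (cases "x * a = a * x")
  case False
  define D where "D v = x * v - v * x" for v
  define q where "q = horner (quotient_list x r) x"
  define T where "T v = D (a * q (g * v))" for v
  define cs where "cs = list_mult [x, -1] (list_mult [a] (list_mult (quotient_list x r) [g]))"
  have S: "x \<in> S" "a \<in> S" "g \<in> S" using x a g by auto
  have cs_eq: "horner cs l v = x * (a * horner (quotient_list x r) l (g * v)) - a * horner (quotient_list x r) l (g * v) * l" for l v
    unfolding cs_def horner_list_mult by simp
  have cs_S: "set cs \<subseteq> S"
    unfolding cs_def using S set_quotient_list[OF S(1)]
    by (intro set_list_mult) auto
  have pow_S: "set ((list_mult cs ^^ n) [1]) \<subseteq> S" for n
  proof (induction n)
    case (Suc n)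
    have "set (list_mult cs ((list_mult cs ^^ n) [1])) \<subseteq> S"
      by (rule set_list_mult) (use Suc cs_S in simp_all)
    then show ?case by simp
  qed simp
  have D_zero_D: "q (D v) = 0" if "v \<in> S" for v
    unfolding q_def D_def horner_quotient_list_diff using Z_commute[OF x(2) that] by simp
  have D_q: "D (q v) = 0" if "v \<in> S" for v
    unfolding q_def D_def diff_horner_quotient_list using Z_commute[OF x(2) that] by simp
  have central_values: "horner ((list_mult cs ^^ M) [1]) l 1 \<in> Z" if l: "l \<in> Z" for l
  proof -
    define ql where "ql = horner (quotient_list x r) l 1"
    have qlS: "ql \<in> S"
      unfolding ql_def by (intro horner_mem set_quotient_list S Z_mem[OF l]) auto
    have ql: "horner (quotient_list x r) l v = ql * v" if "v \<in> S" for v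
      using horner_mult_right[of v l "quotient_list x r" 1] Z_commute[OF l that] by (simp add: ql_def)
    have xl: "x \<noteq> l" using False Z_commute[OF l S(2)] by auto
    define \<nu> where "\<nu> = x ^ r - l ^ r"
    have \<nu>: "\<nu> \<in> Z" unfolding \<nu>_def using x(2) l by simp
    have "(x - l) * ql = \<nu>"
      using diff_horner_quotient_list[of x r l 1] Z_commute[OF l qlS]
      by (simp add: \<nu>_def ql_def left_diff_distrib)
    then have ql_eq: "ql = inverse (x - l) * \<nu>"
      using xl by (metis eq_iff_diff_eq_0 left_inverse mult.assoc mult_1_left)
    define w where "w = (x - l) * a * inverse (x - l) * g"
    have w: "w \<in> N" unfolding w_def using N_conj[OF a, of "x - l"] g S Z_mem[OF l] xl by simp
    have cs_l: "horner cs l v = \<nu> * w * v" if "v \<in> S" for v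
    proof -
      have "horner cs l v = (x - l) * (a * (ql * (g * v)))"
        unfolding cs_eq using ql[of "g * v"] that S qlS Z_commute[OF l, of "a * (ql * (g * v))"]
        by (simp add: left_diff_distrib)
      also have "\<dots> = (x - l) * a * inverse (x - l) * (\<nu> * (g * v))"
        by (simp add: ql_eq mult.assoc)
      also have "\<dots> = \<nu> * ((x - l) * a * inverse (x - l)) * (g * v)"
        using Z_commute[OF \<nu>, of "(x - l) * a * inverse (x - l)"] S Z_mem[OF l]
        by (simp add: mult.assoc)
      finally show ?thesis by (simp add: w_def mult.assoc)
    qed
    have "(horner cs l ^^ n) 1 = \<nu> ^ n * w ^ n \<and> (horner cs l ^^ n) 1 \<in> S" for n
    proof (induction n)
      case (Suc n)
      have "\<nu> * w * (\<nu> ^ n * w ^ n) = \<nu> * (\<nu> ^ n * w) * w ^ n"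
        using Z_commute[of "\<nu> ^ n" w] \<nu> w by (simp add: mult.assoc)
      then show ?case using Suc cs_l[of "(horner cs l ^^ n) 1"] \<nu> w
        by (simp add: mult.assoc Z_mem)
    qed simp
    then show ?thesis
      unfolding horner_list_mult_funpow using \<nu> N_power[OF w] by simp
  qed
  have T_eq: "horner cs x = T"
    by (rule ext) (simp add: cs_eq T_def D_def q_def)
  have TM: "(T ^^ M) v = v * horner ((list_mult cs ^^ M) [1]) x 1" if "v \<in> S" for v
    using horner_Z_coeffs[OF coeffs_in_Z[OF inf pow_S central_values] that, of x]
    by (simp only: horner_list_mult_funpow T_eq)
  define b where "b = D a"
  have b: "b \<in> S" "b \<noteq> 0" using False S by (simp_all add: b_def D_def)
  have T0: "T 0 = 0" by (simp add: T_def q_def D_def)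
  have "T (inverse g * b) = D (a * q (D a))"
    using N_nonzero[OF g] by (simp add: T_def b_def mult.assoc[symmetric])
  also have "\<dots> = 0" using D_zero_D[OF S(2)] by (simp add: D_def)
  finally have "T (inverse g * b) = 0" .
  moreover have "(T ^^ n) 0 = 0" for n by (induction n) (simp_all add: T0)
  ultimately have "(T ^^ M) (inverse g * b) = 0"
    using M_pos by (cases M) (simp_all add: funpow_swap1[of T])
  then have T_nil: "(T ^^ M) v = 0" if "v \<in> S" for v
    using TM[of "inverse g * b"] TM[OF that] b S N_nonzero[OF g] by simp
  \<comment> \<open>\<open>q\<close> maps \<open>S\<close> into the centralizer of \<open>x\<close>,
    so \<open>c\<close> commutes with \<open>x\<close> and \<open>T (b * e) = b * c * e\<close>
    whenever \<open>e\<close> does. Thus \<open>T ^^ M\<close> sends \<open>b\<close> to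
    \<open>b * c ^ M\<close>; this vanishes, hence so does \<open>c\<close>.\<close>
  define c where "c = q (g * b)"
  have cS: "c \<in> S" unfolding c_def q_def using S b by (intro horner_mem set_quotient_list) auto
  have cx: "x * c = c * x" using D_q[of "g * b"] S b by (simp add: D_def c_def)
  have Tb: "T (b * e) = b * (c * e)" if "x * e = e * x" for e
  proof -
    have "q (g * (b * e)) = c * e"
      unfolding c_def q_def using horner_mult_right[of e x _ "g * b"] that by (simp add: mult.assoc)
    then have "T (b * e) = D (a * (c * e))" by (simp add: T_def)
    also have "\<dots> = D a * (c * e)"
      using that cx by (simp add: D_def algebra_simps) (metis mult.assoc)
    finally show ?thesis by (simp add: b_def)
  qed
  have "(T ^^ n) b = b * c ^ n" for n
  proof (induction n)
    case (Suc n)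
    then show ?case using Tb[of "c ^ n"] power_commute_right[of c x n] cx by simp
  qed simp
  then have "b * c ^ M = 0" using T_nil[OF b(1)] by simp
  then show ?thesis using b(2) by (simp add: c_def q_def b_def D_def)
qed simp

end

text \<open>For nonempty \<open>N\<close> this is the additive group generated by \<open>N\<close>;
  additive maps that vanish on \<open>N\<close> vanish on it.\<close>

inductive_set difference_span :: "'a::ring_1 set \<Rightarrow> 'a set" for N where
  base: "a \<in> N \<Longrightarrow> a \<in> difference_span N"
| diff: "a \<in> difference_span N \<Longrightarrow> b \<in> difference_span N \<Longrightarrow> a - b \<in> difference_span N"

lemma difference_span_mult:
  assumes "\<And>a b. a \<in> N \<Longrightarrow> b \<in> N \<Longrightarrow> a * b \<in> N"
    and "u \<in> difference_span N" "v \<in> difference_span N"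
  shows "u * v \<in> difference_span N"
  using assms(2)
proof induction
  case (base a)
  show ?case using assms(3)
    by induction (auto simp: right_diff_distrib assms(1) base intro: difference_span.intros)
qed (auto simp: left_diff_distrib intro: difference_span.intros)

context power_central_normal
begin

interpretation center: division_subring Z
  by (rule division_subring_Z)

text \<open>
  The group commutator \<open>h\<close> of \<open>x\<close> and \<open>a\<close> is algebraic over the center, so \<open>h - 1\<close> has
  a multiple in \<open>\<int>[h]\<close> that is central and nonzero.
\<close>

lemma quotient_vanishes:
  assumes inf: "infinite Z" and x: "x \<in> N" "x ^ r \<in> Z"
    and a: "a \<in> N" "x * a \<noteq> a * x" and u: "u \<in> N"
  shows "horner (quotient_list x r) x u = 0"
proof -
  let ?q = "horner (quotient_list x r) x"
  define h where "h = x * a * inverse x * inverse a"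
  have h: "h \<in> N" using x a by (simp add: h_def)
  have nz: "x \<noteq> 0" "a \<noteq> 0" "h \<noteq> 0" using N_nonzero x a h by blast+
  have comm: "x * a - a * x = (h - 1) * (a * x)"
    using nz by (simp add: h_def left_diff_distrib mult.assoc inverse_mult_cancel_left)
  then have h1: "h \<noteq> 1" using a(2) by auto
  have q_left: "?q (z * v) = z * ?q v" if "z \<in> Z" for z v
    using horner_mult_left[of "quotient_list x r" z x v] set_quotient_list[of x r] x(1) Z_commute[OF that]
    by (metis N_mem subsetD)
  have q_nat: "?q (of_nat k * v) = of_nat k * ?q v" for k v
    by (rule horner_mult_left) (rule mult_of_nat_commute[symmetric])
  \<comment> \<open>\<open>c\<close> is \<open>h ^ M - 1\<close> if that is nonzero. Otherwise
    \<open>h\<close> has a finite order \<open>k\<close>, and weights \<open>j\<close> in the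
    geometric sum give \<open>c = k\<close>, which is nonzero in the division ring.\<close>
  obtain n and f :: "nat \<Rightarrow> nat" and c where
    c: "(\<Sum>i<n. of_nat (f i) * h ^ i) * (h - 1) = c" "c \<in> Z" "c \<noteq> 0"
  proof (cases "h ^ M = 1")
    case False
    show ?thesis
    proof (rule that[where n = M and f = "\<lambda>_. 1" and c = "h ^ M - 1"])
      show "h ^ M - 1 \<in> Z" using N_power[OF h] by simp
    qed (use False in \<open>simp_all add: sum_power_mult_diff_one\<close>)
  next
    case True
    define k where "k = (LEAST k. 0 < k \<and> h ^ k = 1)"
    have k: "0 < k" "h ^ k = 1"
      using LeastI[of "\<lambda>k. 0 < k \<and> h ^ k = 1" M] M_pos True by (auto simp: k_def)
    have "h ^ j \<noteq> 1" if "0 < j" "j < k" for j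
      using that not_less_Least[of j "\<lambda>k. 0 < k \<and> h ^ k = 1"] by (auto simp: k_def)
    then have k0: "of_nat k \<noteq> (0 :: 'a)" using of_nat_order_nonzero[OF k] by blast
    have "(\<Sum>j<k. h ^ j) = 0"
      using sum_power_mult_diff_one[of h k] k h1 by simp
    then have "(\<Sum>j<k. of_nat j * h ^ j) * (h - 1) = of_nat k"
      unfolding sum_of_nat_power_mult_diff_one using k by simp
    moreover have "of_nat k \<in> Z"
      by (induction k) simp_all
    ultimately show ?thesis by (rule that[OF _ _ k0])
  qed
  \<comment> \<open>Chosen so that \<open>g * (a * x) = u\<close>: the elements
    \<open>g * h ^ i * (h - 1) * a * x\<close>, all killed by \<open>?q\<close>, then combine to
    \<open>c * u\<close>.\<close>
  define g where "g = u * inverse x * inverse a"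
  have g: "g \<in> N" using u x a by (simp add: g_def)
  have "?q (g * h ^ i * ((h - 1) * (a * x))) = 0" for i
    using quotient_annihilates_commutators[OF inf x a(1), of "g * h ^ i"] g h comm by simp
  then have "0 = (\<Sum>i<n. of_nat (f i) * ?q (g * h ^ i * ((h - 1) * (a * x))))"
    by simp
  also have "\<dots> = ?q (\<Sum>i<n. of_nat (f i) * (g * h ^ i * ((h - 1) * (a * x))))"
    by (simp add: horner_sum q_nat)
  also have "(\<Sum>i<n. of_nat (f i) * (g * h ^ i * ((h - 1) * (a * x))))
      = g * ((\<Sum>i<n. of_nat (f i) * h ^ i) * (h - 1)) * (a * x)"
  proof -
    have "of_nat m * (g * w) = g * (of_nat m * w)" for m w
      by (metis mult.assoc mult_of_nat_commute)
    then show ?thesis by (simp add: sum_distrib_left sum_distrib_right mult.assoc)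
  qed
  also have "\<dots> = c * (g * (a * x))"
    unfolding c(1) Z_commute[OF c(2) N_mem[OF g], symmetric] by (rule mult.assoc)
  also have "g * (a * x) = u"
    using nz by (simp add: g_def mult.assoc inverse_mult_cancel_left)
  finally show ?thesis using q_left[OF c(2)] c(3) by simp
qed

text \<open>If \<open>x * a \<noteq> a * x\<close>, then \<open>q(1) = 0\<close> forces
  characteristic \<open>r\<close>, and the derivation \<open>D\<close> satisfies
  \<open>D ^^ (r - 1) = 0\<close> on the ring generated by \<open>N\<close>. The last two nonzero
  iterates of \<open>D\<close> on \<open>a\<close> are some \<open>u\<close> and
  \<open>z = D u\<close> with \<open>D z = 0\<close>. But \<open>D ^^ (r - 1)\<close> maps
  \<open>u ^ (r - 1)\<close> to \<open>(r - 1)! z ^ (r - 1)\<close>, which is nonzero.\<close>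

lemma prime_power_central_commutes:
  assumes inf: "infinite Z" and r: "prime r" and x: "x \<in> N" "x ^ r \<in> Z" and a: "a \<in> N"
  shows "x * a = a * x"
proof (rule ccontr)
  assume xa: "x * a \<noteq> a * x"
  let ?q = "horner (quotient_list x r) x"
  have "?q 1 = 0" by (rule quotient_vanishes[OF inf x a xa N_one])
  then have char: "of_nat r = (0 :: 'a)"
    using N_nonzero[OF x(1)] by (simp add: horner_quotient_list_one)
  let ?A = "difference_span N"
  define D where "D v = x * v - v * x" for v
  have q_D: "?q v = (D ^^ (r - 1)) v" for v
    unfolding D_def by (rule funpow_diff_char[OF r char, symmetric])
  have q_A: "?q v = 0" if "v \<in> ?A" for v
    using that by induction (simp_all add: quotient_vanishes[OF inf x a xa] horner_diff)
  have A_mult: "v * w \<in> ?A" if "v \<in> ?A" "w \<in> ?A" for v w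
    using difference_span_mult[of N v w] that by simp
  have A_D: "D v \<in> ?A" if "v \<in> ?A" for v
    unfolding D_def using that difference_span.base[OF x(1)] by (intro difference_span.diff A_mult)
  have A_Dn: "(D ^^ n) a \<in> ?A" for n
    by (induction n) (simp_all add: A_D a difference_span.base)
  have "\<exists>n. (D ^^ n) a = 0"
    using q_A[of a] q_D[of a] a by (metis difference_span.base)
  then obtain n where n: "(D ^^ n) a = 0" "\<And>m. m < n \<Longrightarrow> (D ^^ m) a \<noteq> 0"
    using exists_least_iff[of "\<lambda>n. (D ^^ n) a = 0"] by blast
  have "(D ^^ 0) a \<noteq> 0" "(D ^^ 1) a \<noteq> 0"
    using N_nonzero[OF a] xa by (simp_all add: D_def)
  then have "n \<noteq> 0" "n \<noteq> 1" using n(1) by metis+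
  then obtain k where k: "n = Suc (Suc k)" by (metis One_nat_def not0_implies_Suc)
  define u where "u = (D ^^ k) a"
  define z where "z = D u"
  have u: "u \<in> ?A" by (simp add: u_def A_Dn)
  have z: "z \<noteq> 0" "x * z = z * x"
    using n(2)[of "Suc k"] n(1) k by (simp_all add: z_def u_def D_def)
  have D_mult: "D (v * w) = D v * w + v * D w" for v w
    by (simp add: D_def algebra_simps)
  have D_z: "D (z ^ m) = 0" for m
    using power_commute_right[of z x m] z(2) by (simp add: D_def)
  have D_nat: "D (of_nat m * v) = of_nat m * D v" for m v
  proof -
    have "x * (of_nat m * v) = of_nat m * (x * v)"
      by (metis mult.assoc mult_of_nat_commute)
    then show ?thesis by (simp add: D_def right_diff_distrib mult.assoc)
  qed
  have D_add: "D (v + w) = D v + D w" for v w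
    by (simp add: D_def algebra_simps)
  \<comment> \<open>Only two terms of Leibniz' rule survive because \<open>D (D u) = 0\<close>; for
    \<open>m = 0\<close> the term with the truncated \<open>m - 1\<close> has coefficient 0.\<close>
  have leibniz: "(D ^^ m) (u * v) = u * (D ^^ m) v + of_nat m * (z * (D ^^ (m - 1)) v)" for m v
  proof (induction m)
    case (Suc m)
    have "(D ^^ Suc m) (u * v) = z * (D ^^ m) v + u * (D ^^ Suc m) v + of_nat m * (z * D ((D ^^ (m - 1)) v))"
      using Suc D_z[of 1] by (simp add: D_add D_nat D_mult[of u] D_mult[of z] z_def[symmetric])
    also have "of_nat m * (z * D ((D ^^ (m - 1)) v)) = of_nat m * (z * (D ^^ m) v)"
      by (cases m) simp_all
    finally show ?case by (simp add: algebra_simps)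
  qed simp
  have D_pow: "(D ^^ m) (u ^ m) = of_nat (fact m) * z ^ m" for m
  proof (induction m)
    case (Suc m)
    have "(D ^^ Suc m) (u ^ m) = 0" using Suc D_z by (simp add: D_nat)
    then have "(D ^^ Suc m) (u ^ Suc m) = of_nat (Suc m) * (z * (of_nat (fact m) * z ^ m))"
      using leibniz[of "Suc m" "u ^ m"] Suc by simp
    also have "z * (of_nat (fact m) * z ^ m) = of_nat (fact m) * z ^ Suc m"
      by (metis mult.assoc mult_of_nat_commute power_Suc)
    finally show ?case by (simp only: fact_Suc of_nat_mult of_nat_id mult.assoc)
  qed simp
  have "u ^ Suc m \<in> ?A" for m
    by (induction m) (simp_all add: u A_mult)
  then have "u ^ (r - 1) \<in> ?A"
    using prime_gt_1_nat[OF r] by (metis Suc_pred zero_less_diff)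
  then have "(D ^^ (r - 1)) (u ^ (r - 1)) = 0"
    using q_A q_D by simp
  then have "of_nat (fact (r - 1)) = (0 :: 'a)"
    using D_pow z(1) by simp
  then have "CHAR('a) dvd fact (r - 1)" and "CHAR('a) dvd r"
    using char by (simp_all only: of_nat_eq_0_iff_char_dvd)
  then have "r dvd fact (r - 1)"
    using r CHAR_not_1[where ?'a = 'a] by (metis One_nat_def prime_nat_iff)
  then show False
    using prime_dvd_fact_iff[OF r, of "r - 1"] prime_gt_0_nat[OF r] by simp
qed

text \<open>Descent on the exponent: for \<open>n = r * m\<close> with \<open>r\<close> prime,
  \<open>x ^ m\<close> commutes with all of \<open>N\<close>, in particular with its own conjugates,
  hence is central, and \<open>n\<close> drops to \<open>m\<close>.\<close>

theorem infinite_center_imp_central: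
  assumes inf: "infinite Z"
  shows "N \<subseteq> Z"
proof
  have prime_case: "x \<in> Z" if "prime r" "x \<in> N" "x ^ r \<in> Z" for x and r :: nat
    by (rule commutes_with_conjugates_imp_central)
      (use that in \<open>auto intro!: prime_power_central_commutes[OF inf] N_conj\<close>)
  fix x assume x: "x \<in> N"
  have "x ^ n \<in> Z \<Longrightarrow> 0 < n \<Longrightarrow> x \<in> Z" for n
  proof (induction n rule: less_induct)
    case (less n)
    show ?case
    proof (cases "n = 1")
      case False
      then obtain r where r: "prime r" "r dvd n"
        using prime_factor_nat by blast
      then obtain m where n: "n = r * m" by blast
      have "(x ^ m) ^ r \<in> Z" using less.prems(1) n by (metis mult.commute power_mult)
      then have "x ^ m \<in> Z" by (rule prime_case[OF r(1) N_pow[OF x]])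
      moreover have "0 < m" "m < n" using n less.prems(2) prime_gt_1_nat[OF r(1)] by auto
      ultimately show ?thesis using less.IH by blast
    qed (use less.prems in simp)
  qed
  then show "x \<in> Z" using N_power[OF x] M_pos by blast
qed

end

section \<open>Cyclic algebras over finite fields\<close>

text \<open>Subtracting \<open>\<mu> k\<close> times the relation for \<open>s\<close> from the one
  for \<open>s + 1\<close> removes the index \<open>k\<close> and multiplies every other
  \<open>w i\<close> by the nonzero \<open>\<mu> i - \<mu> k\<close>.\<close>

lemma vandermonde_independent:
  fixes \<mu> w :: "'i \<Rightarrow> 'a::division_ring"
  assumes "finite I" "inj_on \<mu> I" "\<And>i j. i \<in> I \<Longrightarrow> j \<in> I \<Longrightarrow> \<mu> i * \<mu> j = \<mu> j * \<mu> i"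
    and "\<And>s. (\<Sum>i\<in>I. \<mu> i ^ s * w i) = 0"
  shows "\<forall>i\<in>I. w i = 0"
  using assms
proof (induction I arbitrary: w rule: finite_induct)
  case (insert k I)
  have "(\<Sum>i\<in>I. \<mu> i ^ s * ((\<mu> i - \<mu> k) * w i)) = 0" for s
  proof -
    have "\<mu> i ^ s * ((\<mu> i - \<mu> k) * w i) = \<mu> i ^ Suc s * w i - \<mu> k * (\<mu> i ^ s * w i)" if "i \<in> I" for i
      using power_commute_right[of "\<mu> i" "\<mu> k" s] insert.prems(2)[of i k] that
      by (simp add: left_diff_distrib right_diff_distrib mult.assoc[symmetric] power_commutes)
    then have "(\<Sum>i\<in>I. \<mu> i ^ s * ((\<mu> i - \<mu> k) * w i))
        = (\<Sum>i\<in>I. \<mu> i ^ Suc s * w i) - \<mu> k * (\<Sum>i\<in>I. \<mu> i ^ s * w i)"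
      by (simp add: sum_subtractf sum_distrib_left)
    also have "\<dots> = (\<Sum>i\<in>insert k I. \<mu> i ^ Suc s * w i) - \<mu> k * (\<Sum>i\<in>insert k I. \<mu> i ^ s * w i)"
      using insert.hyps by (simp add: distrib_left mult.assoc)
    finally show ?thesis by (simp only: insert.prems(3)) simp
  qed
  then have *: "\<forall>i\<in>I. (\<mu> i - \<mu> k) * w i = 0"
    by (intro insert.IH) (use insert.prems in auto)
  have "w i = 0" if "i \<in> I" for i
  proof -
    have "\<mu> i \<noteq> \<mu> k" using insert.prems(1) insert.hyps that by (auto simp: inj_on_def)
    then show ?thesis using * that by auto
  qed
  then show ?case using insert.prems(3)[of 0] insert.hyps by simp
qed simp

lemma finite_powers_imp_torsion:
  fixes v :: "'a::division_ring"
  assumes "finite V" "\<And>i. v ^ i \<in> V" "v \<noteq> 0"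
  shows "\<exists>k>0. v ^ k = 1"
proof -
  have "\<not> inj (\<lambda>i. v ^ i)"
    using finite_imageD[of "\<lambda>i. v ^ i" UNIV] finite_subset[OF _ assms(1)] assms(2) by (metis image_subsetI infinite_UNIV_nat)
  then obtain i j where "i < j" "v ^ i = v ^ j"
    by (metis injI linorder_neqE_nat)
  have "v ^ j = v ^ i * v ^ (j - i)" using \<open>i < j\<close> by (simp add: power_add[symmetric])
  with \<open>v ^ i = v ^ j\<close> have "v ^ i * v ^ (j - i) = v ^ i * 1" by simp
  then show ?thesis using assms(3) \<open>i < j\<close> by (intro exI[of _ "j - i"]) simp
qed

text \<open>
  By Wedderburn's theorem on finite division rings the assumptions of this locale are
  contradictory; \<open>inconsistent\<close> below is the part of that theorem needed here.
\<close>

locale normalized_finite_field = division_subring K for K :: "'a::division_ring set" +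
  fixes a b :: 'a and m :: nat
  assumes finite_K: "finite K"
    and K_commute: "x \<in> K \<Longrightarrow> y \<in> K \<Longrightarrow> x * y = y * x"
    and a_mem: "a \<in> K"
    and b_nonzero: "b \<noteq> 0"
    and b_conj: "x \<in> K \<Longrightarrow> b * x * inverse b \<in> K"
    and b_power: "b ^ m \<in> K"
    and m_gt_1: "1 < m"
    and m_least: "0 < i \<Longrightarrow> i < m \<Longrightarrow> b ^ i * a \<noteq> a * b ^ i"
begin

section \<open>Conjugates of \<open>a\<close> and norms of the cyclic algebra\<close>

definition \<mu> :: "nat \<Rightarrow> 'a" where "\<mu> i = b ^ i * a * inverse (b ^ i)"

lemma sum_mem: "(\<And>i. i \<in> I \<Longrightarrow> f i \<in> K) \<Longrightarrow> sum f I \<in> K"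
  by (induction I rule: infinite_finite_induct) simp_all

lemma b_power_conj: "x \<in> K \<Longrightarrow> b ^ i * x * inverse (b ^ i) \<in> K"
proof (induction i)
  case (Suc i)
  have "b ^ Suc i * x * inverse (b ^ Suc i) = b * (b ^ i * x * inverse (b ^ i)) * inverse b"
    using b_nonzero by (simp add: nonzero_inverse_mult_distrib mult.assoc)
  then show ?case using Suc b_conj by simp
qed simp

lemma \<mu>_mem: "\<mu> i \<in> K"
  unfolding \<mu>_def by (rule b_power_conj[OF a_mem])

lemma inj_\<mu>: "inj_on \<mu> {..<m}"
proof (rule linorder_inj_onI)
  fix i j assume "i < j" "j \<in> {..<m}"
  show "\<mu> i \<noteq> \<mu> j"
  proof
    assume eq: "\<mu> i = \<mu> j"
    have bj: "b ^ j = b ^ i * b ^ (j - i)" using \<open>i < j\<close> by (simp add: power_add[symmetric])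
    have "b ^ i * (a * b ^ (j - i)) = \<mu> i * b ^ j"
      using b_nonzero bj by (simp add: \<mu>_def mult.assoc inverse_mult_cancel_left)
    also have "\<dots> = b ^ i * (b ^ (j - i) * a)"
      unfolding eq using b_nonzero bj by (simp add: \<mu>_def mult.assoc)
    finally have "a * b ^ (j - i) = b ^ (j - i) * a" using b_nonzero by simp
    moreover have "0 < j - i" "j - i < m"
      using \<open>i < j\<close> \<open>j \<in> {..<m}\<close> by (simp_all add: less_imp_diff_less)
    ultimately show False using m_least by metis
  qed
qed auto

lemma exists_nonzero_sum:
  assumes "w 0 \<noteq> 0"
  shows "\<exists>s. (\<Sum>i<m. \<mu> i ^ s * w i) \<noteq> 0"
proof (rule ccontr)
  assume "\<not> ?thesis"
  then have "\<forall>i\<in>{..<m}. w i = 0"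
    by (intro vandermonde_independent[OF _ inj_\<mu>]) (auto intro: K_commute \<mu>_mem)
  then show False using assms m_gt_1 by auto
qed

text \<open>\<open>c\<close> is a partial norm, the product of the conjugates of \<open>k\<close> by
  \<open>b ^ 0\<close> up to \<open>b ^ (i - 1)\<close>.\<close>

lemma twisted_power:
  assumes "k \<in> K" "k \<noteq> 0"
  obtains c where "c \<in> K" "c \<noteq> 0" "(k * b) ^ i = c * b ^ i"
proof -
  have "\<exists>c. c \<in> K \<and> c \<noteq> 0 \<and> (k * b) ^ i = c * b ^ i"
  proof (induction i)
    case 0
    show ?case by (intro exI[of _ 1]) simp
  next
    case (Suc i)
    then obtain c where c: "c \<in> K" "c \<noteq> 0" "(k * b) ^ i = c * b ^ i" by blast
    show ?case
    proof (intro exI[of _ "k * (b * c * inverse b)"] conjI)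
      show "(k * b) ^ Suc i = k * (b * c * inverse b) * b ^ Suc i"
        using c(3) b_nonzero by (simp add: mult.assoc inverse_mult_cancel_left)
    qed (use assms c b_conj b_nonzero in simp_all)
  qed
  then show ?thesis using that by blast
qed

lemma twisted_power_eigen:
  assumes "k \<in> K" "k \<noteq> 0"
  shows "(k * b) ^ i * a ^ s = \<mu> i ^ s * (k * b) ^ i"
proof -
  obtain c where c: "c \<in> K" "(k * b) ^ i = c * b ^ i" using twisted_power[OF assms] by metis
  have ba: "b ^ i * a = \<mu> i * b ^ i"
    using b_nonzero by (simp add: \<mu>_def mult.assoc)
  have *: "(k * b) ^ i * a = \<mu> i * (k * b) ^ i"
  proof -
    have "(k * b) ^ i * a = c * \<mu> i * b ^ i" using c(2) ba by (simp add: mult.assoc)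
    also have "c * \<mu> i = \<mu> i * c" using K_commute[OF c(1) \<mu>_mem] .
    finally show ?thesis using c(2) by (simp add: mult.assoc)
  qed
  show ?thesis
  proof (induction s)
    case (Suc s)
    have "(k * b) ^ i * a ^ Suc s = (k * b) ^ i * a * a ^ s" by (simp add: mult.assoc)
    also have "\<dots> = \<mu> i * ((k * b) ^ i * a ^ s)" unfolding * by (simp add: mult.assoc)
    finally show ?case unfolding Suc by (simp add: mult.assoc)
  qed simp
qed

text \<open>The unit group of the fixed field of conjugation by \<open>b\<close>; zero is left out
  because unit groups are counted below.\<close>

definition E :: "'a set" where "E = {k \<in> K - {0}. k * b = b * k}"

lemma twisted_norm_mem:
  assumes "k \<in> K" "k \<noteq> 0"
  shows "(k * b) ^ m \<in> E"
proof -
  obtain c where c: "c \<in> K" "c \<noteq> 0" "(k * b) ^ m = c * b ^ m" using twisted_power[OF assms] by metis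
  have K: "(k * b) ^ m \<in> K" unfolding c(3) using c(1) b_power by simp
  have "b * (k * b) ^ m = (k * b) ^ m * b"
    by (rule commute_cancel_left[OF assms(2) K_commute[OF assms(1) K]]) (simp add: power_commutes)
  then show ?thesis using K assms b_nonzero by (simp add: E_def)
qed

text \<open>Hilbert 90; the conjugating element \<open>x\<close> is the usual resolvent sum.\<close>

lemma twisted_norm_eq_imp_conjugate:
  assumes k: "k \<in> K" "k \<noteq> 0" and l: "l \<in> K" "l \<noteq> 0" and eq: "(k * b) ^ m = (l * b) ^ m"
  shows "\<exists>x\<in>K - {0}. k * b * x = x * (l * b)"
proof -
  define w where "w i = (k * b) ^ i * inverse ((l * b) ^ i)" for i
  have w_mem: "w i \<in> K" for i
  proof -
    obtain c where c: "c \<in> K" "c \<noteq> 0" "(k * b) ^ i = c * b ^ i" using twisted_power[OF k] by metis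
    obtain d where d: "d \<in> K" "d \<noteq> 0" "(l * b) ^ i = d * b ^ i" using twisted_power[OF l] by metis
    have "w i = c * inverse d"
      unfolding w_def c(3) d(3) using b_nonzero d(2)
      by (simp add: nonzero_inverse_mult_distrib mult.assoc) (simp add: mult.assoc[symmetric])
    then show ?thesis using c d by simp
  qed
  obtain s where s: "(\<Sum>i<m. \<mu> i ^ s * w i) \<noteq> 0"
    using exists_nonzero_sum[of w] by (auto simp: w_def)
  define x where "x = (\<Sum>i<m. \<mu> i ^ s * w i)"
  define t where "t i = (k * b) ^ i * a ^ s * inverse ((l * b) ^ i)" for i
  have x: "x = (\<Sum>i<m. t i)"
    unfolding x_def t_def w_def twisted_power_eigen[OF k] by (simp only: mult.assoc)
  have lb: "l * b \<noteq> 0" using l b_nonzero by simp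
  \<comment> \<open>The summands are shifted cyclically: \<open>t m = t 0\<close>, because the two
    \<open>m\<close>-th powers agree and lie in \<open>K\<close>.\<close>
  have t_Suc: "t (Suc i) = k * b * t i * inverse (l * b)" for i
  proof -
    have "inverse ((l * b) ^ Suc i) = inverse ((l * b) ^ i) * inverse (l * b)"
      using lb by (subst nonzero_inverse_mult_distrib[symmetric]) simp_all
    then show ?thesis by (simp add: t_def mult.assoc)
  qed
  have "k * b * x * inverse (l * b) = (\<Sum>i<m. t (Suc i))"
    by (simp only: x t_Suc sum_distrib_left sum_distrib_right)
  also have "\<dots> = (\<Sum>i<Suc m. t i) - t 0"
    by (simp only: sum.lessThan_Suc_shift add_diff_cancel_left')
  also have "\<dots> = x + (t m - t 0)"
    by (simp add: x)
  also have "t m = t 0"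
  proof -
    have "(l * b) ^ m \<in> K" using twisted_norm_mem[OF l] by (simp add: E_def)
    then have "(l * b) ^ m * a ^ s = a ^ s * (l * b) ^ m"
      by (rule K_commute) (simp add: a_mem)
    then show ?thesis unfolding t_def eq using lb by (simp add: mult.assoc)
  qed
  finally have eq: "k * b * x * inverse (l * b) = x" by simp
  have "k * b * x = k * b * x * inverse (l * b) * (l * b)"
    unfolding mult.assoc[of _ "inverse (l * b)"] left_inverse[OF lb] by simp
  then have "k * b * x = x * (l * b)" unfolding eq .
  moreover have "x \<in> K"
    unfolding x_def by (intro sum_mem mult_mem power_mem \<mu>_mem w_mem)
  ultimately show ?thesis using s by (auto simp: x_def)
qed

text \<open>Fix \<open>l\<close> in the fiber. For \<open>s\<close> in \<open>E\<close> the element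
  \<open>x k * s\<close> conjugates \<open>l * b\<close> to \<open>k * b\<close>, so it determines
  \<open>k\<close> and then \<open>s\<close>. These products embed the fiber times \<open>E\<close>
  into the units of \<open>K\<close>.\<close>

lemma norm_fiber_card:
  "card {k \<in> K - {0}. (k * b) ^ m = e} * card E \<le> card (K - {0})"
proof (cases "{k \<in> K - {0}. (k * b) ^ m = e} = {}")
  case False
  let ?F = "{k \<in> K - {0}. (k * b) ^ m = e}"
  obtain l where l: "l \<in> K" "l \<noteq> 0" "(l * b) ^ m = e" using False by blast
  obtain x where x: "\<And>k. k \<in> ?F \<Longrightarrow> x k \<in> K - {0} \<and> k * b * x k = x k * (l * b)"
    using twisted_norm_eq_imp_conjugate[OF _ _ l(1,2)] l(3) by (simp add: Bex_def) metis
  have "inj_on (\<lambda>(k, s). x k * s) (?F \<times> E)"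
  proof (rule inj_onI)
    fix p q assume "p \<in> ?F \<times> E" "q \<in> ?F \<times> E" and pq: "(\<lambda>(k, s). x k * s) p = (\<lambda>(k, s). x k * s) q"
    then obtain k s k' s' where p: "p = (k, s)" and q: "q = (k', s')"
      and F: "k \<in> ?F" "k' \<in> ?F" and s: "s \<in> E" "s' \<in> E"
      by (elim SigmaE) blast
    have eq: "x k * s = x k' * s'" using pq by (simp add: p q)
    have conj: "k * b * (x k * s) = x k * s * (l * b)" if "k \<in> ?F" "s \<in> E" for k s
    proof -
      have "s * (l * b) = l * b * s"
        using that(2) K_commute[OF _ l(1), of s] by (simp add: E_def mult.assoc[symmetric]) (simp add: mult.assoc)
      then have "x k * s * (l * b) = x k * (l * b) * s" by (simp only: mult.assoc)
      also have "\<dots> = k * b * x k * s" using x[OF that(1)] by simp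
      finally show ?thesis by (simp only: mult.assoc)
    qed
    have nz: "x k * s \<noteq> 0" using x[OF F(1)] s by (simp add: E_def)
    have "k * b * (x k * s) = k' * b * (x k * s)"
      using conj[OF F(1) s(1)] conj[OF F(2) s(2)] eq by simp
    then have "k = k'" using nz b_nonzero by simp
    then show "p = q" using eq x[OF F(1)] by (simp add: p q)
  qed
  moreover have "(\<lambda>(k, s). x k * s) ` (?F \<times> E) \<subseteq> K - {0}"
    using x by (auto simp: E_def)
  ultimately have "card (?F \<times> E) \<le> card (K - {0})"
    by (rule card_inj_on_le) (simp add: finite_K)
  then show ?thesis by (simp only: card_cartesian_product)
next
  case True
  show ?thesis unfolding True by simp
qed

text \<open>All norms lie in \<open>E\<close>. If 1 were missed, the fibers over the other
  \<open>card E - 1\<close> values would be too small to fill \<open>K - {0}\<close>.\<close>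

lemma exists_norm_one: "\<exists>k\<in>K - {0}. (k * b) ^ m = 1"
proof (rule ccontr)
  assume none: "\<not> ?thesis"
  let ?F = "\<lambda>e. {k \<in> K - {0}. (k * b) ^ m = e}"
  have fE: "finite E" using finite_K by (simp add: E_def)
  have one: "1 \<in> E" by (simp add: E_def)
  have K_eq: "K - {0} = (\<Union>e\<in>E - {1}. ?F e)"
    using none twisted_norm_mem by auto
  have "card (K - {0}) \<le> (\<Sum>e\<in>E - {1}. card (?F e))"
    by (subst K_eq, rule card_UN_le) (simp add: fE)
  then have "card (K - {0}) * card E \<le> (\<Sum>e\<in>E - {1}. card (?F e)) * card E"
    by (rule mult_le_mono1)
  also have "\<dots> = (\<Sum>e\<in>E - {1}. card (?F e) * card E)"
    by (rule sum_distrib_right)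
  also have "\<dots> \<le> (\<Sum>e\<in>E - {1}. card (K - {0}))"
    by (intro sum_mono norm_fiber_card)
  also have "\<dots> = (card E - 1) * card (K - {0})"
    using one fE by simp
  finally have "card (K - {0}) * card E \<le> (card E - 1) * card (K - {0})" .
  moreover have "0 < card E" using one fE by (auto simp: card_gt_0_iff)
  moreover have "1 \<in> K - {0}" by simp
  then have "0 < card (K - {0})" using finite_K by (metis card_gt_0_iff empty_iff finite_Diff)
  ultimately show False by (cases "card E") auto
qed

text \<open>Since \<open>y = k * b \<noteq> 1\<close> and \<open>y ^ m = 1\<close>, the powers
  \<open>y ^ i\<close> with \<open>i < m\<close> sum to 0. Multiplying by \<open>a ^ s\<close> on
  the right and moving it across gives weights \<open>\<mu> i ^ s\<close> for every
  \<open>s\<close>, against the Vandermonde argument.\<close>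

theorem inconsistent: False
proof -
  obtain k where k: "k \<in> K" "k \<noteq> 0" and one: "(k * b) ^ m = 1"
    using exists_norm_one by blast
  have "k * b \<noteq> 1"
  proof
    assume "k * b = 1"
    then have "a = \<mu> 1" using twisted_power_eigen[OF k, of 1 1] by simp
    then have "\<mu> 0 = \<mu> 1" by (simp add: \<mu>_def)
    then show False using inj_\<mu> m_gt_1 by (auto simp: inj_on_def)
  qed
  then have zero: "(\<Sum>i<m. (k * b) ^ i) = 0"
    using sum_power_mult_diff_one[of "k * b" m] one by simp
  have "(\<Sum>i<m. \<mu> i ^ s * (k * b) ^ i) = 0" for s
    using zero sum_distrib_right[of "\<lambda>i. (k * b) ^ i" "{..<m}" "a ^ s"]
    by (simp add: twisted_power_eigen[OF k])
  then show False
    using exists_nonzero_sum[of "\<lambda>i. (k * b) ^ i"] by simp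
qed

end

text \<open>\<open>root_span E a n\<close> is the ring \<open>E[a]\<close> when \<open>a ^ n = 1\<close> and \<open>a\<close> commutes with \<open>E\<close>.\<close>

definition root_span :: "'a::ring_1 set \<Rightarrow> 'a \<Rightarrow> nat \<Rightarrow> 'a set" where
  "root_span E a n = (\<lambda>f. \<Sum>i<n. f i * a ^ i) ` {f. \<forall>i. f i \<in> E}"

lemma finite_root_span:
  assumes "finite E"
  shows "finite (root_span E a n)"
proof -
  have "root_span E a n \<subseteq> (\<lambda>f. \<Sum>i<n. f i * a ^ i) ` (PiE {..<n} (\<lambda>_. E))"
  proof
    fix v assume "v \<in> root_span E a n"
    then obtain f where "\<forall>i. f i \<in> E" "v = (\<Sum>i<n. f i * a ^ i)" by (auto simp: root_span_def)
    then show "v \<in> (\<lambda>f. \<Sum>i<n. f i * a ^ i) ` (PiE {..<n} (\<lambda>_. E))"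
      by (intro image_eqI[of _ _ "restrict f {..<n}"]) auto
  qed
  then show ?thesis by (rule finite_subset) (simp add: assms finite_PiE)
qed

locale root_extension = division_subring E for E :: "'a::division_ring set" +
  fixes a :: 'a and n :: nat
  assumes finite_E: "finite E"
    and E_commute: "x \<in> E \<Longrightarrow> y \<in> E \<Longrightarrow> x * y = y * x"
    and a_commute: "x \<in> E \<Longrightarrow> a * x = x * a"
    and n_pos: "0 < n"
    and a_power: "a ^ n = 1"
begin

abbreviation V :: "'a set" where "V \<equiv> root_span E a n"

lemma V_E: "v \<in> V \<longleftrightarrow> (\<exists>f. (\<forall>i. f i \<in> E) \<and> v = (\<Sum>i<n. f i * a ^ i))"
  by (auto simp: root_span_def)

lemma V_diff: "v \<in> V \<Longrightarrow> w \<in> V \<Longrightarrow> v - w \<in> V"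
  unfolding V_E
proof (elim exE conjE)
  fix f g assume "\<forall>i. f i \<in> E" "\<forall>i. g i \<in> E" "v = (\<Sum>i<n. f i * a ^ i)" "w = (\<Sum>i<n. g i * a ^ i)"
  then show "\<exists>f. (\<forall>i. f i \<in> E) \<and> v - w = (\<Sum>i<n. f i * a ^ i)"
    by (intro exI[of _ "\<lambda>i. f i - g i"]) (simp add: left_diff_distrib sum_subtractf)
qed

lemma V_monomial:
  assumes "e \<in> E"
  shows "e * a ^ i \<in> V"
  unfolding V_E
proof (intro exI conjI allI)
  have "a ^ i = a ^ (i mod n)" by (rule power_eq_power_mod[OF a_power])
  then show "e * a ^ i = (\<Sum>j<n. (if j = i mod n then e else 0) * a ^ j)"
    using n_pos by (simp add: if_distrib[of "\<lambda>x. x * _"] sum.delta cong: if_cong)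
qed (use assms in simp)

lemma V_sum:
  assumes "\<And>i. i \<in> I \<Longrightarrow> f i \<in> V"
  shows "sum f I \<in> V"
  using assms
proof (induction I rule: infinite_finite_induct)
  case (insert i I)
  have "0 \<in> V" using V_monomial[of 0 0] by simp
  then have "f i - (0 - sum f I) \<in> V" using insert by (intro V_diff) auto
  then show ?case using insert.hyps by simp
qed (use V_monomial[of 0 0] in simp_all)

lemma power_a_commute: "x \<in> E \<Longrightarrow> a ^ i * x = x * a ^ i"
  by (rule power_commute_right) (rule a_commute)

lemma V_mult:
  assumes "v \<in> V" "w \<in> V"
  shows "v * w \<in> V"
proof -
  obtain f g where f: "\<forall>i. f i \<in> E" "v = (\<Sum>i<n. f i * a ^ i)"
    and g: "\<forall>i. g i \<in> E" "w = (\<Sum>i<n. g i * a ^ i)"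
    using assms unfolding V_E by blast
  have "f i * a ^ i * (g j * a ^ j) = f i * g j * a ^ (i + j)" for i j
  proof -
    have "f i * a ^ i * (g j * a ^ j) = f i * (a ^ i * g j) * a ^ j" by (simp add: mult.assoc)
    then show ?thesis using power_a_commute[of "g j" i] g by (simp add: mult.assoc power_add)
  qed
  then have "v * w = (\<Sum>i<n. \<Sum>j<n. f i * g j * a ^ (i + j))"
    by (simp add: f(2) g(2) sum_product)
  also have "\<dots> \<in> V" using f g by (intro V_sum V_monomial mult_mem) auto
  finally show ?thesis .
qed

lemma V_commute:
  assumes "v \<in> V" "\<And>x. x \<in> E \<Longrightarrow> x * c = c * x" "a * c = c * a"
  shows "v * c = c * v"
proof -
  obtain f where f: "\<forall>i. f i \<in> E" "v = (\<Sum>i<n. f i * a ^ i)"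
    using assms unfolding V_E by blast
  have "f i * a ^ i * c = c * (f i * a ^ i)" for i
  proof -
    have "f i * a ^ i * c = f i * c * a ^ i"
      using power_commute_right[OF assms(3), of i] by (simp add: mult.assoc)
    then show ?thesis using assms(2) f(1) by (simp add: mult.assoc)
  qed
  then show ?thesis unfolding f(2) by (simp add: sum_distrib_left sum_distrib_right)
qed

lemma V_commutative:
  assumes "v \<in> V" "w \<in> V"
  shows "v * w = w * v"
proof (rule V_commute[OF assms(1)])
  show "x * w = w * x" if "x \<in> E" for x
    by (rule V_commute[OF assms(2), symmetric]) (simp_all add: that E_commute a_commute)
  show "a * w = w * a"
    by (rule V_commute[OF assms(2), symmetric]) (simp_all add: a_commute)
qed

lemma E_subset_V: "E \<subseteq> V"
  using V_monomial[of _ 0] by auto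

lemma a_mem_V: "a \<in> V"
  using V_monomial[of 1 1] by simp

text \<open>\<open>V\<close> is finite and closed under products, so the inverse of a nonzero
  element is one of its powers.\<close>

lemma division_subring_V: "division_subring V"
proof
  show one: "1 \<in> V" using E_subset_V by auto
  show "inverse v \<in> V" if v: "v \<in> V" for v
  proof (cases "v = 0")
    case False
    have pow: "v ^ i \<in> V" for i
      by (induction i) (use one v V_mult in auto)
    obtain k where k: "0 < k" "v ^ k = 1"
      using finite_powers_imp_torsion[OF finite_root_span[OF finite_E] pow False] by blast
    then have "v * v ^ (k - 1) = 1" by (cases k) auto
    then have "inverse v = v ^ (k - 1)" by (rule inverse_unique)
    then show ?thesis using pow by simp
  qed (use v in simp)
qed (use V_diff V_mult in auto)

lemma V_conj:
  assumes "v \<in> V" "b \<noteq> 0" "\<And>x. x \<in> E \<Longrightarrow> b * x = x * b" "b * a = a ^ j * b"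
  shows "b * v * inverse b \<in> V"
proof -
  obtain f where f: "\<forall>i. f i \<in> E" "v = (\<Sum>i<n. f i * a ^ i)"
    using assms unfolding V_E by blast
  have "b * (f i * a ^ i) * inverse b = f i * a ^ (j * i)" for i
  proof -
    have "b * (f i * a ^ i) = f i * (b * a ^ i)"
      using assms(3) f(1) by (simp add: mult.assoc[symmetric])
    then show ?thesis using assms(2) by (simp add: mult_power_twist[OF assms(4)] mult.assoc)
  qed
  then have "b * v * inverse b = (\<Sum>i<n. f i * a ^ (j * i))"
    unfolding f(2) sum_distrib_left sum_distrib_right by simp
  also have "\<dots> \<in> V" using f by (intro V_sum V_monomial) auto
  finally show ?thesis .
qed

end

section \<open>Finite center\<close>

text \<open>A discrete Fourier decomposition of \<open>v\<close> under conjugation by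
  \<open>a\<close>, with powers of \<open>a\<close> itself as left coefficients:
  \<open>w j * a = a ^ j * w j\<close>, and the \<open>w j\<close> sum to \<open>k * v\<close> by
  orthogonality. If every \<open>w j\<close> commuted with \<open>a\<close>, so would
  \<open>v\<close>, as the order \<open>k\<close> is nonzero in the division ring.\<close>

lemma exists_noncommuting_eigenvector:
  fixes a v :: "'a::division_ring"
  assumes "0 < n" "a ^ n = 1" "v * a \<noteq> a * v"
  shows "\<exists>b j. b \<noteq> 0 \<and> b * a = a ^ j * b \<and> a ^ j \<noteq> a"
proof (rule ccontr)
  assume none: "\<not> ?thesis"
  define k where "k = (LEAST k. 0 < k \<and> a ^ k = 1)"
  have k: "0 < k" "a ^ k = 1"
    using LeastI[of "\<lambda>k. 0 < k \<and> a ^ k = 1" n] assms by (auto simp: k_def)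
  have kmin: "a ^ j \<noteq> 1" if "0 < j" "j < k" for j
    using that not_less_Least[of j "\<lambda>k. 0 < k \<and> a ^ k = 1"] by (auto simp: k_def)
  have a0: "a \<noteq> 0" using k by (auto simp: power_0_left)
  have ia: "inverse a ^ k = 1" using k(2) by (simp add: power_inverse)
  define t where "t j i = a ^ (j * i) * v * inverse a ^ i" for j i
  define w where "w j = (\<Sum>i<k. t j i)" for j
  have w: "w j * a = a ^ j * w j" for j
  proof -
    have "t j (Suc i) = a ^ j * t j i * inverse a" for i
      by (simp add: t_def power_add mult.assoc power_commutes)
    then have "a ^ j * w j * inverse a = (\<Sum>i<k. t j (Suc i))"
      by (simp add: w_def sum_distrib_left sum_distrib_right)
    also have "\<dots> = (\<Sum>i<Suc k. t j i) - t j 0"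
      by (simp only: sum.lessThan_Suc_shift add_diff_cancel_left')
    also have "\<dots> = w j + (t j k - t j 0)"
      by (simp add: w_def)
    also have "t j k = t j 0"
      using k(2) ia by (simp add: t_def mult.commute[of j] power_mult)
    finally have eq: "a ^ j * w j * inverse a = w j" by simp
    have "a ^ j * w j = a ^ j * w j * inverse a * a"
      using a0 by (simp add: mult.assoc)
    then show ?thesis unfolding eq by simp
  qed
  have wa: "w j * a = a * w j" for j
  proof (cases "w j = 0")
    case False
    then have "a ^ j = a" using none w[of j] by blast
    then show ?thesis using w[of j] by simp
  qed simp
  have col: "(\<Sum>j<k. t j i) = (if i = 0 then of_nat k * v else 0)" if i: "i < k" for i
  proof (cases "i = 0")
    case False
    have "(\<Sum>j<k. (a ^ i) ^ j) * (a ^ i - 1) = (a ^ i) ^ k - 1"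
      by (rule sum_power_mult_diff_one)
    also have "(a ^ i) ^ k = 1"
      using k(2) by (metis mult.commute power_mult power_one)
    finally have z: "(\<Sum>j<k. (a ^ i) ^ j) = 0"
      using kmin[of i] False i by simp
    have "(\<Sum>j<k. t j i) = (\<Sum>j<k. (a ^ i) ^ j) * (v * inverse a ^ i)"
      unfolding t_def sum_distrib_right
      by (intro sum.cong refl) (simp add: mult.commute[of _ i] power_mult mult.assoc)
    then show ?thesis using z False by simp
  qed (simp add: t_def)
  have "(\<Sum>j<k. w j) = (\<Sum>i<k. \<Sum>j<k. t j i)"
    unfolding w_def by (rule sum.swap)
  also have "\<dots> = (\<Sum>i<k. if i = 0 then of_nat k * v else 0)"
    by (intro sum.cong refl) (simp add: col)
  also have "\<dots> = of_nat k * v"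
    using k(1) by (simp add: sum.delta)
  finally have sum_w: "(\<Sum>j<k. w j) = of_nat k * v" .
  have "(\<Sum>j<k. w j) * a = a * (\<Sum>j<k. w j)"
    unfolding sum_distrib_left sum_distrib_right by (simp only: wa)
  then have "of_nat k * (v * a) = of_nat k * (a * v)"
    unfolding sum_w by (metis mult.assoc mult_of_nat_commute)
  then show False
    using of_nat_order_nonzero[OF k kmin] assms(3) by simp
qed

text \<open>Moving \<open>a\<close> across \<open>b ^ i\<close> raises it to the power
  \<open>j ^ i\<close>. Only finitely many powers of \<open>a\<close> exist, so two of these
  coincide.\<close>

lemma twisted_power_commutes:
  fixes a b :: "'a::division_ring"
  assumes "0 < n" "a ^ n = 1" "b \<noteq> 0" "b * a = a ^ j * b"
  shows "\<exists>m>0. b ^ m * a = a * b ^ m"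
proof -
  have ba: "b ^ i * a = a ^ (j ^ i) * b ^ i" for i
  proof (induction i)
    case (Suc i)
    have "b ^ Suc i * a = b * a ^ (j ^ i) * b ^ i" using Suc by (simp add: mult.assoc)
    then show ?case unfolding mult_power_twist[OF assms(4)] by (simp add: mult.assoc)
  qed simp
  have "range (\<lambda>i. a ^ (j ^ i)) \<subseteq> (\<lambda>i. a ^ i) ` {..<n}"
    using assms(1) power_eq_power_mod[OF assms(2)] by (auto intro!: image_eqI[of _ _ "_ mod n"])
  then have "\<not> inj (\<lambda>i. a ^ (j ^ i))"
    using finite_imageD[of "\<lambda>i. a ^ (j ^ i)" UNIV] finite_subset by blast
  then obtain i k where ik: "i < k" "a ^ (j ^ i) = a ^ (j ^ k)"
    by (metis injI linorder_neqE_nat)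
  have bk: "b ^ k = b ^ i * b ^ (k - i)" using ik(1) by (simp add: power_add[symmetric])
  have "b ^ i * (b ^ (k - i) * a) = a ^ (j ^ i) * b ^ k"
    using ba[of k] ik(2) bk by (simp add: mult.assoc)
  also have "\<dots> = b ^ i * (a * b ^ (k - i))"
    unfolding bk using ba[of i] by (simp add: mult.assoc[symmetric])
  finally have "b ^ (k - i) * a = a * b ^ (k - i)" using assms(3) by simp
  then show ?thesis using ik(1) by (intro exI[of _ "k - i"]) simp
qed

lemma division_subring_UNIV: "division_subring UNIV"
  by unfold_locales simp_all

lemma division_subring_centralizer:
  fixes t :: "'a::division_ring"
  shows "division_subring {x. x * t = t * x}"
proof
  show "inverse x \<in> {x. x * t = t * x}" if "x \<in> {x. x * t = t * x}" for x
  proof (cases "x = 0")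
    case False
    then show ?thesis
      using commute_cancel_left[of x t "inverse x"] that by simp
  qed (use that in simp)
  show "x * y \<in> {x. x * t = t * x}" if "x \<in> {x. x * t = t * x}" "y \<in> {x. x * t = t * x}" for x y
  proof -
    have "x * y * t = x * (t * y)" using that by (simp add: mult.assoc)
    also have "\<dots> = t * x * y" using that by (simp add: mult.assoc[symmetric])
    finally show ?thesis by (simp add: mult.assoc)
  qed
qed (simp_all add: left_diff_distrib right_diff_distrib)

lemma finite_center_imp_central:
  assumes "power_central_normal UNIV N M" and fin: "finite (division_subring.Z (UNIV :: 'a::division_ring set))"
  shows "N \<subseteq> division_subring.Z (UNIV :: 'a set)"
proof
  interpret power_central_normal "UNIV :: 'a set" N M by fact
  interpret F: division_subring Z by (rule division_subring_Z)
  fix a assume a: "a \<in> N"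
  show "a \<in> Z"
  proof (rule ccontr)
    assume "a \<notin> Z"
    then obtain v where v: "v * a \<noteq> a * v" by (metis UNIV_I Z_I)
    have a0: "a \<noteq> 0" by (rule N_nonzero[OF a])
    obtain k where k: "0 < k" "(a ^ M) ^ k = 1"
      using finite_powers_imp_torsion[OF fin F.power_mem[OF N_power[OF a]]] a0 by auto
    define n where "n = M * k"
    have n: "0 < n" "a ^ n = 1" using k M_pos by (simp_all add: n_def power_mult)
    obtain b j where b: "b \<noteq> 0" "b * a = a ^ j * b" "a ^ j \<noteq> a"
      using exists_noncommuting_eigenvector[OF n v] by blast
    define m where "m = (LEAST m. 0 < m \<and> b ^ m * a = a * b ^ m)"
    have m: "0 < m" "b ^ m * a = a * b ^ m"
      using LeastI_ex[OF twisted_power_commutes[OF n b(1,2)]] by (simp_all add: m_def)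
    have m_least: "b ^ i * a \<noteq> a * b ^ i" if "0 < i" "i < m" for i
      using that not_less_Least[of i "\<lambda>m. 0 < m \<and> b ^ m * a = a * b ^ m"] by (auto simp: m_def)
    have ba: "b * a \<noteq> a * b" using b by auto
    have m1: "1 < m" using m ba by (cases "m = 1") auto
    \<comment> \<open>Pass to the centralizer \<open>C\<close> of \<open>b ^ m\<close>: it contains
      \<open>a\<close> and \<open>b\<close>, makes \<open>b ^ m\<close> central, and
      \<open>N \<inter> C\<close> inherits the hypotheses because elements central in the whole ring
      are central in \<open>C\<close>.\<close>
    define t where "t = b ^ m"
    define C where "C = {x. x * t = t * x}"
    interpret C: division_subring C unfolding C_def by (rule division_subring_centralizer)
    have aC: "a \<in> C" using m(2) by (simp add: C_def t_def)
    have bC: "b \<in> C" by (simp add: C_def t_def power_commutes)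
    interpret C: power_central_normal C "N \<inter> C" M
    proof
      show "y * x * inverse y \<in> N \<inter> C" if "x \<in> N \<inter> C" "y \<in> C" "y \<noteq> 0" for x y
        using that N_conj by simp
      show "x ^ M \<in> C.Z" if "x \<in> N \<inter> C" for x
        using that N_power[of x] by (intro C.Z_I) (auto dest: Z_commute)
    qed (use N_nonzero M_pos in auto)
    show False
    proof (cases "finite C.Z")
      case False
      then have "a \<in> C.Z" using C.infinite_center_imp_central a aC by blast
      then show False using C.Z_commute[OF _ bC] ba by metis
    next
      case True
      \<comment> \<open>Adjoining \<open>a\<close> to the center of \<open>C\<close> gives a finite
        field that \<open>b\<close> normalizes and that contains \<open>b ^ m\<close>.\<close>
      interpret E: division_subring C.Z by (rule C.division_subring_Z)
      interpret V: root_extension C.Z a n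
      proof
        show "x * y = y * x" if "x \<in> C.Z" "y \<in> C.Z" for x y
          by (rule C.Z_commute[OF that(1) C.Z_mem[OF that(2)]])
        show "a * x = x * a" if "x \<in> C.Z" for x
          by (rule C.Z_commute[OF that aC, symmetric])
      qed (use True n in auto)
      interpret VV: division_subring V.V by (rule V.division_subring_V)
      have "t \<in> C.Z"
        by (rule C.Z_I) (simp_all add: C_def)
      then have "b ^ m \<in> V.V" using V.E_subset_V t_def by auto
      then interpret W: normalized_finite_field V.V a b m
      proof unfold_locales
        show "b * x * inverse b \<in> V.V" if "x \<in> V.V" for x
          by (rule V.V_conj[OF that b(1) _ b(2)]) (rule C.Z_commute[OF _ bC, symmetric])
      qed (use V.V_commutative V.a_mem_V b(1) m1 m_least finite_root_span[OF True] in auto)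
      show False by (rule W.inconsistent)
    qed
  qed
qed

section \<open>Translation to the group structure \<open>unit_group\<close>\<close>

lemma center_eq_Z: "center = division_subring.Z (UNIV :: 'a::division_ring set)"
proof -
  interpret division_subring "UNIV :: 'a set" by (rule division_subring_UNIV)
  show ?thesis by (simp add: center_def Z_def)
qed

lemma inv_unit_group:
  assumes "x \<noteq> (0 :: 'a::division_ring)"
  shows "inv\<^bsub>unit_group\<^esub> x = inverse x"
  by (rule group.inv_equality[OF group_unit_group]) (use assms in \<open>simp_all add: unit_group_def\<close>)

theorem theorem1p1:
  fixes N :: "'a::division_ring set"
  assumes "N \<lhd> unit_group"
    and "\<exists>d::nat. 0 < d \<and> (\<forall>x\<in>N. \<exists>n. 0 < n \<and> n \<le> d \<and> n_central n x)"
  shows "N \<subseteq> center"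
proof -
  obtain d :: nat where d: "\<And>x. x \<in> N \<Longrightarrow> \<exists>n. 0 < n \<and> n \<le> d \<and> n_central n x"
    using assms(2) by blast
  interpret U: division_subring "UNIV :: 'a set" by (rule division_subring_UNIV)
  interpret F: division_subring U.Z by (rule U.division_subring_Z)
  interpret normal N unit_group by fact
  have N0: "x \<noteq> 0" if "x \<in> N" for x
    using mem_carrier[OF that] by (simp add: unit_group_def)
  have N: "power_central_normal UNIV N (fact d)"
  proof
    show "1 \<in> N" using subgroup.one_closed[OF subgroup_axioms] by (simp add: unit_group_def)
    show "x * y \<in> N" if "x \<in> N" "y \<in> N" for x y
      using subgroup.m_closed[OF subgroup_axioms that] by (simp add: unit_group_def)
    show "inverse x \<in> N" if "x \<in> N" for x
      using subgroup.m_inv_closed[OF subgroup_axioms that] by (simp add: inv_unit_group N0[OF that])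
    show "y * x * inverse y \<in> N" if "x \<in> N" "y \<noteq> 0" for x y
    proof -
      have "y \<in> carrier unit_group" using that(2) by (simp add: unit_group_def)
      from inv_op_closed2[OF this that(1)] show ?thesis
        using that(2) by (simp add: inv_unit_group) (simp add: unit_group_def)
    qed
    show "x ^ fact d \<in> U.Z" if x: "x \<in> N" for x
    proof -
      obtain n where n: "0 < n" "n \<le> d" "x ^ n \<in> U.Z"
        using d[OF x] by (auto simp: n_central_def center_eq_Z)
      then have "n dvd fact d" by (intro dvd_fact) auto
      then obtain k where "fact d = n * k" by blast
      then show ?thesis using n(3) by (simp add: power_mult)
    qed
  qed (use N0 in auto)
  show ?thesis
  proof (cases "finite U.Z")
    case True
    then show ?thesis unfolding center_eq_Z using finite_center_imp_central[OF N] by blast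
  next
    case False
    then show ?thesis unfolding center_eq_Z
      using power_central_normal.infinite_center_imp_central[OF N] by blast
  qed
qed

end
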